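(* Let $x\in D_\infty$ be a strictly positive infinitesimal, and let $p\in\mathbb{R}_{>0}$. Suppose that in the decomposition of $x$ no term loses information in $x^{\frac1p}$. Then $$\left(x^{\frac1p}\right)^p=x .$$ Therefore, the power $(-)^{p}$ is an injection on the set $$\left\{x\in D_\infty\mid x>0,\ \text{all terms of }x\text{ are complete with respect to }x^{\frac1p}\right\}\cup\left\{y\in{}^\bullet\mathbb{R}\mid{}^\circ y>0\right\}.$$
   Context: Fermat reals. A little-oh polynomial is a function $x:\mathbb{R}_{\ge0}\to\mathbb{R}$ such that $x(t)=r+\sum_{i=1}^N a_i t^{\alpha_i}+o(t)$ as $t\to0^+$, for some $N\in\mathbb{N}$, $r,a_i\in\mathbb{R}$, $\alpha_i\in\mathbb{R}_{\ge0}$. Put $x\sim y$ iff $x(t)=y(t)+o(t)$ as $t\to0^+$. The ring ${}^\bullet\mathbb{R}$ of Fermat reals is the quotient of the ring of little-oh polynomials (pointwise operations) by $\sim$; it contains $\mathbb{R}$. For real $a>0$, $\mathrm{d}t_a$ denotes the class of $t\mapsto t^{1/a}$ (so $\mathrm{d}t_a=0$ iff $a<1$). Every $x\in{}^\bullet\mathbb{R}$ can be written uniquely as $x={}^\circ x+\sum_{j=1}^N b_j\,\mathrm{d}t_{\beta_j}$ with ${}^\circ x,b_j\in\mathbb{R}$, $b_j\ne0$, $\beta_1>\dots>\beta_N\ge1$, $N\ge0$ (the decomposition of $x$). $D_\infty:=\{x\mid{}^\circ x=0\}$ is the set of infinitesimals; for $x\in D_\infty\setminus\{0\}$, $x>0$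 means $b_1>0$. For $a,b\in(0,\infty]$ put $a\oplus b:=(\frac1a+\frac1b)^{-1}$ and $a\ominus b:=(\frac1a-\frac1b)^{-1}$, with $1/\infty=0$, $1/0=\infty$; $\bigoplus_j a_j:=(\sum_j1/a_j)^{-1}$. Powers. For $y\in{}^\bullet\mathbb{R}$ with ${}^\circ y>0$ and $p\in\mathbb{R}$, $y^p$ is the class of $t\mapsto y(t)^p$ ($t$ small); in particular $(1+h)^p=1+\sum_{n\ge1}\binom pn h^n$ (a finite sum) for $h\in D_\infty$. For $c\in D_\infty$, $c>0$, with decomposition $c=\sum_{j=1}^N b_j\,\mathrm{d}t_{\beta_j}$, and $p\in\mathbb{R}_{>0}$, $c^p:=b_1^p\,\mathrm{d}t_{\frac{\beta_1}p}\cdot\left(1+\sum_{j=2}^N\frac{b_j}{b_1}\,\mathrm{d}t_{\beta_j\ominus\beta_1}\right)^p$. Completeness. Let $x>0$ be in $D_\infty$ with decomposition $\sum_{j=1}^N b_j\,\mathrm{d}t_{\beta_j}$, and let $s>0$ be a real exponent. For $\gamma\in\mathbb{N}^{N-1}$ (where $0\in\mathbb{N}$) put $|\gamma|:=\sum_i\gamma_i$, $\omega(x,\gamma):=\bigoplus_{j=2}^N\frac{\beta_j\ominus\beta_1}{\gamma_{j-1}}$, and (for $N\ge2$) $k_{x,s}:=\lceil\beta_2\ominus\beta_1\rceil$ if $s\notin\mathbb{N}$, $k_{x,s}:=\min(\lceil\beta_2\ominus\beta_1\rceil,s)$ if $s\in\mathbb{N}$. The term $\mathrm{d}t_{\beta_1}$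 loses information in $x^s$ (is incomplete with respect to $x^s$) iff $\beta_1<s$. For $r>1$, $\mathrm{d}t_{\beta_r}$ loses information in $x^s$ iff there exist $n\in\{1,\dots,k_{x,s}\}$ and $\gamma\in\mathbb{N}^{N-1}$ with $|\gamma|=n$, $\gamma_{r-1}\ne0$ and $\omega(x,\gamma)\oplus\frac{\beta_1}s<1$. A term is complete if it does not lose information.
   Formalization: The printed injectivity of $(-)^p$ fails for every $p>1$ ($\mathrm{d}t_1$ and $2\,\mathrm{d}t_1$ both go to 0), so it is stated only for $p\le1$; for all $p>0$ the injectivity of $(-)^{1/p}$ on the same set is stated instead. *)

theory Defs
  imports "HOL-Analysis.Analysis" "HOL-Real_Asymp.Real_Asymp"
begin

section \<open>Little-oh polynomials\<close>

text \<open>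
  Only the behaviour for \<open>t\<close> tending to \<open>0\<close> from the right matters, so functions on the
  nonnegative reals are represented by total functions whose values at negative
  arguments are ignored.
\<close>

definition little_oh_poly :: "(real \<Rightarrow> real) \<Rightarrow> bool" where
  "little_oh_poly x \<longleftrightarrow>
     (\<exists>(N::nat) (r::real) (a::nat \<Rightarrow> real) (\<alpha>::nat \<Rightarrow> real).
        (\<forall>i\<in>{1..N}. \<alpha> i \<ge> 0) \<and>
        (\<lambda>t. x t - (r + (\<Sum>i=1..N. a i * t powr \<alpha> i))) \<in> o[at_right 0](\<lambda>t. t))"

definition fermat_rel :: "(real \<Rightarrow> real) \<Rightarrow> (real \<Rightarrow> real) \<Rightarrow> bool" where
  "fermat_rel x y \<longleftrightarrow> little_oh_poly x \<and> little_oh_poly y \<and>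
     (\<lambda>t. x t - y t) \<in> o[at_right 0](\<lambda>t. t)"

definition powr_sum :: "real set \<Rightarrow> (real \<Rightarrow> real) \<Rightarrow> real \<Rightarrow> real" where
  "powr_sum A c t = (\<Sum>\<alpha>\<in>A. c \<alpha> * t powr \<alpha>)"

definition is_powr_sum :: "(real \<Rightarrow> real) \<Rightarrow> bool" where
  "is_powr_sum f \<longleftrightarrow> (\<exists>A c. finite A \<and> A \<subseteq> {0..} \<and> (\<forall>t>0. f t = powr_sum A c t))"

lemma powr_sum_mono:
  assumes "finite B" "A \<subseteq> B"
  shows "powr_sum A c t = powr_sum B (\<lambda>\<alpha>. if \<alpha> \<in> A then c \<alpha> else 0) t"
proof -
  have "(\<Sum>\<alpha>\<in>B. (if \<alpha> \<in> A then c \<alpha> else 0) * t powr \<alpha>) = (\<Sum>\<alpha>\<in>A. (if \<alpha> \<in> A then c \<alpha> else 0) * t powr \<alpha>)"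
    using assms by (intro sum.mono_neutral_right) auto
  also have "\<dots> = (\<Sum>\<alpha>\<in>A. c \<alpha> * t powr \<alpha>)" by (intro sum.cong) auto
  finally show ?thesis by (simp add: powr_sum_def)
qed

lemma is_powr_sum_monom: "\<alpha> \<ge> 0 \<Longrightarrow> is_powr_sum (\<lambda>t. a * t powr \<alpha>)"
  unfolding is_powr_sum_def powr_sum_def
  by (rule exI[of _ "{\<alpha>}"], rule exI[of _ "\<lambda>_. a"]) auto

lemma is_powr_sum_cong: "(\<And>t. t > 0 \<Longrightarrow> f t = g t) \<Longrightarrow> is_powr_sum f \<longleftrightarrow> is_powr_sum g"
  unfolding is_powr_sum_def by auto

lemma is_powr_sum_const: "is_powr_sum (\<lambda>t. a)"
  using is_powr_sum_monom[of 0 a] by (subst is_powr_sum_cong[of _ "\<lambda>t. a * t powr 0"]) auto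

lemma is_powr_sum_add:
  assumes "is_powr_sum f" "is_powr_sum g"
  shows "is_powr_sum (\<lambda>t. f t + g t)"
proof -
  obtain A c where A: "finite A" "A \<subseteq> {0..}" "\<And>t. t > 0 \<Longrightarrow> f t = powr_sum A c t"
    using assms unfolding is_powr_sum_def by auto
  obtain B d where B: "finite B" "B \<subseteq> {0..}" "\<And>t. t > 0 \<Longrightarrow> g t = powr_sum B d t"
    using assms unfolding is_powr_sum_def by auto
  define c' where "c' = (\<lambda>\<alpha>. (if \<alpha> \<in> A then c \<alpha> else 0) + (if \<alpha> \<in> B then d \<alpha> else 0))"
  have "f t + g t = powr_sum (A \<union> B) c' t" if "t > 0" for t
    unfolding A(3)[OF that] B(3)[OF that] c'_def
    by (subst powr_sum_mono[of "A \<union> B" A], use A B in simp, simp,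
        subst powr_sum_mono[of "A \<union> B" B], use A B in simp, simp)
       (simp only: powr_sum_def ring_distribs sum.distrib)
  with A B show ?thesis unfolding is_powr_sum_def
    by (intro exI[of _ "A \<union> B"] exI[of _ c']) auto
qed

lemma is_powr_sum_sum:
  "(\<And>i. i \<in> I \<Longrightarrow> is_powr_sum (f i)) \<Longrightarrow> is_powr_sum (\<lambda>t. \<Sum>i\<in>I. f i t)"
  by (induction I rule: infinite_finite_induct) (auto intro: is_powr_sum_add is_powr_sum_const)

lemma is_powr_sum_mult:
  assumes "is_powr_sum f" "is_powr_sum g"
  shows "is_powr_sum (\<lambda>t. f t * g t)"
proof -
  obtain A c where A: "finite A" "A \<subseteq> {0..}" "\<And>t. t > 0 \<Longrightarrow> f t = powr_sum A c t"
    using assms unfolding is_powr_sum_def by auto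
  obtain B d where B: "finite B" "B \<subseteq> {0..}" "\<And>t. t > 0 \<Longrightarrow> g t = powr_sum B d t"
    using assms unfolding is_powr_sum_def by auto
  have "is_powr_sum (\<lambda>t. \<Sum>\<alpha>\<in>A. \<Sum>\<beta>\<in>B. (c \<alpha> * d \<beta>) * t powr (\<alpha> + \<beta>))"
    using A(2) B(2) by (intro is_powr_sum_sum is_powr_sum_monom) (auto intro!: add_nonneg_nonneg)
  also have "?this \<longleftrightarrow> is_powr_sum (\<lambda>t. f t * g t)"
    using A(3) B(3) by (intro is_powr_sum_cong)
      (simp add: powr_sum_def sum_product powr_add mult_ac)
  finally show ?thesis .
qed

lemma powr_sum_as_list:
  assumes "is_powr_sum f"
  shows "\<exists>(N::nat) a \<alpha>. (\<forall>i\<in>{1..N}. \<alpha> i \<ge> 0) \<and> (\<forall>t>0. f t = (\<Sum>i=1..N. a i * t powr \<alpha> i))"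
proof -
  obtain A c where A: "finite A" "A \<subseteq> {0..}" "\<And>t. t > 0 \<Longrightarrow> f t = powr_sum A c t"
    using assms unfolding is_powr_sum_def by auto
  obtain h where h: "bij_betw h {1..card A} A"
    using A(1) ex_bij_betw_nat_finite_1 by blast
  have "powr_sum A c t = (\<Sum>i=1..card A. c (h i) * t powr h i)" for t
    unfolding powr_sum_def using sum.reindex_bij_betw[OF h, of "\<lambda>\<alpha>. c \<alpha> * t powr \<alpha>"] by simp
  moreover have "h i \<ge> 0" if "i \<in> {1..card A}" for i
    using h that A(2) by (auto simp: bij_betw_def)
  ultimately show ?thesis using A(3)
    by (intro exI[of _ "card A"] exI[of _ "\<lambda>i. c (h i)"] exI[of _ h]) auto
qed

lemma little_oh_poly_iff:
  "little_oh_poly x \<longleftrightarrow> (\<exists>f. is_powr_sum f \<and> (\<lambda>t. x t - f t) \<in> o[at_right 0](\<lambda>t. t))"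
proof
  assume "little_oh_poly x"
  then obtain N :: nat and r a \<alpha> where *: "\<forall>i\<in>{1..N}. \<alpha> i \<ge> 0"
    "(\<lambda>t. x t - (r + (\<Sum>i=1..N. a i * t powr \<alpha> i))) \<in> o[at_right 0](\<lambda>t. t)"
    unfolding little_oh_poly_def by blast
  have "is_powr_sum (\<lambda>t. r + (\<Sum>i=1..N. a i * t powr \<alpha> i))"
    using * by (intro is_powr_sum_add is_powr_sum_sum is_powr_sum_const is_powr_sum_monom) auto
  with * show "\<exists>f. is_powr_sum f \<and> (\<lambda>t. x t - f t) \<in> o[at_right 0](\<lambda>t. t)" by blast
next
  assume "\<exists>f. is_powr_sum f \<and> (\<lambda>t. x t - f t) \<in> o[at_right 0](\<lambda>t. t)"
  then obtain f where f: "is_powr_sum f" "(\<lambda>t. x t - f t) \<in> o[at_right 0](\<lambda>t. t)" by blast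
  obtain N :: nat and a \<alpha> where *: "\<forall>i\<in>{1..N}. \<alpha> i \<ge> 0"
      "\<And>t. t > 0 \<Longrightarrow> f t = (\<Sum>i=1..N. a i * t powr \<alpha> i)"
    using powr_sum_as_list[OF f(1)] by blast
  have "eventually (\<lambda>t::real. t > 0) (at_right 0)" by (simp add: eventually_at_right_less)
  hence "eventually (\<lambda>t. x t - f t = x t - (0 + (\<Sum>i=1..N. a i * t powr \<alpha> i))) (at_right 0)"
    by eventually_elim (simp add: *)
  from landau_o.small.in_cong[OF this, of "\<lambda>t. t"] f(2)
  have "(\<lambda>t. x t - (0 + (\<Sum>i=1..N. a i * t powr \<alpha> i))) \<in> o[at_right 0](\<lambda>t. t)" by blast
  with * show "little_oh_poly x" unfolding little_oh_poly_def by blast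
qed

lemma is_powr_sum_bounded:
  assumes "is_powr_sum f"
  shows "f \<in> O[at_right 0](\<lambda>_. 1)"
proof -
  obtain A c where A: "finite A" "A \<subseteq> {0..}" "\<And>t. t > 0 \<Longrightarrow> f t = powr_sum A c t"
    using assms unfolding is_powr_sum_def by auto
  have m: "(\<lambda>t. c \<alpha> * t powr \<alpha>) \<in> O[at_right 0](\<lambda>_. 1)" if "\<alpha> \<ge> 0" for \<alpha>
  proof (rule bigoI[of _ "\<bar>c \<alpha>\<bar>"])
    have "eventually (\<lambda>t::real. t \<in> {0<..<1}) (at_right 0)"
      by (rule eventually_at_right_real) simp
    thus "\<forall>\<^sub>F t in at_right 0. norm (c \<alpha> * t powr \<alpha>) \<le> \<bar>c \<alpha>\<bar> * norm (1::real)"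
    proof eventually_elim
      case (elim t)
      have "t powr \<alpha> \<le> 1" using elim that by (intro powr_le1) auto
      thus ?case by (simp add: abs_mult mult_left_le)
    qed
  qed
  have "(\<lambda>t. powr_sum A c t) \<in> O[at_right 0](\<lambda>_. 1)"
    unfolding powr_sum_def using A(2) m by (intro big_sum_in_bigo) auto
  moreover have "eventually (\<lambda>t. f t = powr_sum A c t) (at_right 0)"
    using eventually_at_right_less[of "0::real"] by eventually_elim (simp add: A)
  ultimately show ?thesis using landau_o.big.in_cong by blast
qed

lemma small_id_bounded: "f \<in> o[at_right 0](\<lambda>t. t) \<Longrightarrow> f \<in> O[at_right 0](\<lambda>_. 1::real)"
proof -
  assume "f \<in> o[at_right 0](\<lambda>t::real. t)"
  moreover have "(\<lambda>t::real. t) \<in> O[at_right 0](\<lambda>_. 1)" by real_asymp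
  ultimately show ?thesis
    using landau_o.small_imp_big landau_o.big_trans by blast
qed

lemma little_oh_poly_bounded:
  assumes "little_oh_poly x"
  shows "x \<in> O[at_right 0](\<lambda>_. 1)"
proof -
  obtain f where f: "is_powr_sum f" "(\<lambda>t. x t - f t) \<in> o[at_right 0](\<lambda>t. t)"
    using assms little_oh_poly_iff by auto
  have "(\<lambda>t. (x t - f t) + f t) \<in> O[at_right 0](\<lambda>_. 1)"
    using f by (intro sum_in_bigo(1) small_id_bounded is_powr_sum_bounded)
  thus ?thesis by simp
qed

lemma little_oh_poly_powr_sum: "is_powr_sum f \<Longrightarrow> little_oh_poly f"
  unfolding little_oh_poly_iff by (rule exI[of _ f]) auto

lemma little_oh_poly_add:
  assumes "little_oh_poly x" "little_oh_poly y"
  shows "little_oh_poly (\<lambda>t. x t + y t)"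
proof -
  obtain f g where *: "is_powr_sum f" "(\<lambda>t. x t - f t) \<in> o[at_right 0](\<lambda>t. t)"
     "is_powr_sum g" "(\<lambda>t. y t - g t) \<in> o[at_right 0](\<lambda>t. t)"
    using assms little_oh_poly_iff by auto
  have "(\<lambda>t. (x t - f t) + (y t - g t)) \<in> o[at_right 0](\<lambda>t. t)"
    using * by (intro sum_in_smallo(1))
  also have "(\<lambda>t. (x t - f t) + (y t - g t)) = (\<lambda>t. (x t + y t) - (f t + g t))"
    by (simp add: algebra_simps)
  finally show ?thesis unfolding little_oh_poly_iff using is_powr_sum_add[OF *(1,3)] by blast
qed

lemma small_mult_bounded:
  "f \<in> o[at_right 0](\<lambda>t. t) \<Longrightarrow> g \<in> O[at_right 0](\<lambda>_. 1) \<Longrightarrow>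
     (\<lambda>t. f t * g t :: real) \<in> o[at_right 0](\<lambda>t. t)"
  using landau_o.small_big_mult[of f "at_right 0" "\<lambda>t. t" g "\<lambda>_. 1"] by simp

lemma small_mult_diff:
  assumes "(\<lambda>t. x t - x' t) \<in> o[at_right 0](\<lambda>t. t)" "(\<lambda>t. y t - y' t) \<in> o[at_right 0](\<lambda>t. t)"
    and "y \<in> O[at_right 0](\<lambda>_. 1)" "x' \<in> O[at_right 0](\<lambda>_. 1)"
  shows "(\<lambda>t. x t * y t - x' t * y' t :: real) \<in> o[at_right 0](\<lambda>t. t)"
proof -
  have "(\<lambda>t. (x t - x' t) * y t + (y t - y' t) * x' t) \<in> o[at_right 0](\<lambda>t. t)"
    using assms by (intro sum_in_smallo(1) small_mult_bounded)
  thus ?thesis by (simp add: algebra_simps)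
qed

lemma little_oh_poly_mult:
  assumes "little_oh_poly x" "little_oh_poly y"
  shows "little_oh_poly (\<lambda>t. x t * y t)"
proof -
  obtain f g where *: "is_powr_sum f" "(\<lambda>t. x t - f t) \<in> o[at_right 0](\<lambda>t. t)"
     "is_powr_sum g" "(\<lambda>t. y t - g t) \<in> o[at_right 0](\<lambda>t. t)"
    using assms little_oh_poly_iff by auto
  have "(\<lambda>t. x t * y t - f t * g t) \<in> o[at_right 0](\<lambda>t. t)"
    using * assms by (intro small_mult_diff little_oh_poly_bounded is_powr_sum_bounded)
  with * show ?thesis unfolding little_oh_poly_iff
    by (intro exI[of _ "\<lambda>t. f t * g t"]) (auto intro: is_powr_sum_mult)
qed

lemma little_oh_poly_const: "little_oh_poly (\<lambda>_. c)"
  by (intro little_oh_poly_powr_sum is_powr_sum_const)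

lemma little_oh_poly_diff:
  assumes "little_oh_poly x" "little_oh_poly y"
  shows "little_oh_poly (\<lambda>t. x t - y t)"
  using little_oh_poly_add[OF assms(1) little_oh_poly_mult[OF little_oh_poly_const[of "-1"] assms(2)]]
  by simp

lemma little_oh_poly_powr: "\<alpha> \<ge> 0 \<Longrightarrow> little_oh_poly (\<lambda>t. t powr \<alpha>)"
  using is_powr_sum_monom[of \<alpha> 1] by (intro little_oh_poly_powr_sum) simp


section \<open>The ring of Fermat reals\<close>

quotient_type fermat = "real \<Rightarrow> real" / partial: fermat_rel
proof (rule part_equivpI)
  show "\<exists>x. fermat_rel x x"
    by (rule exI[of _ "\<lambda>_. 0"]) (simp add: fermat_rel_def little_oh_poly_const)
  show "symp fermat_rel"
  proof (rule sympI)
    fix x y assume "fermat_rel x y"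
    thus "fermat_rel y x" unfolding fermat_rel_def
      using landau_o.small.uminus_in_iff[of "\<lambda>t. x t - y t"] by auto
  qed
  show "transp fermat_rel"
  proof (rule transpI)
    fix x y z assume *: "fermat_rel x y" "fermat_rel y z"
    hence "(\<lambda>t. (x t - y t) + (y t - z t)) \<in> o[at_right 0](\<lambda>t. t)"
      unfolding fermat_rel_def by (intro sum_in_smallo(1)) auto
    with * show "fermat_rel x z" unfolding fermat_rel_def by simp
  qed
qed

lemma fermat_rel_refl_iff: "fermat_rel x x \<longleftrightarrow> little_oh_poly x"
  by (simp add: fermat_rel_def)

lemma fermat_rel_add:
  assumes "fermat_rel x x'" "fermat_rel y y'"
  shows "fermat_rel (\<lambda>t. x t + y t) (\<lambda>t. x' t + y' t)"
proof -
  have "(\<lambda>t. (x t - x' t) + (y t - y' t)) \<in> o[at_right 0](\<lambda>t. t)"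
    using assms unfolding fermat_rel_def by (intro sum_in_smallo(1)) auto
  thus ?thesis using assms unfolding fermat_rel_def
    by (auto simp: algebra_simps intro: little_oh_poly_add)
qed

lemma fermat_rel_mult:
  assumes "fermat_rel x x'" "fermat_rel y y'"
  shows "fermat_rel (\<lambda>t. x t * y t) (\<lambda>t. x' t * y' t)"
  using assms unfolding fermat_rel_def
  by (auto intro: little_oh_poly_mult small_mult_diff little_oh_poly_bounded)

lemma fermat_rel_const: "fermat_rel (\<lambda>_. c) (\<lambda>_. c)"
  by (simp add: fermat_rel_def little_oh_poly_const)

instantiation fermat :: comm_ring_1
begin

lift_definition zero_fermat :: fermat is "\<lambda>_. 0" by (rule fermat_rel_const)
lift_definition one_fermat :: fermat is "\<lambda>_. 1" by (rule fermat_rel_const)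
lift_definition plus_fermat :: "fermat \<Rightarrow> fermat \<Rightarrow> fermat" is "\<lambda>x y t. x t + y t"
  by (rule fermat_rel_add)
lift_definition times_fermat :: "fermat \<Rightarrow> fermat \<Rightarrow> fermat" is "\<lambda>x y t. x t * y t"
  by (rule fermat_rel_mult)
lift_definition uminus_fermat :: "fermat \<Rightarrow> fermat" is "\<lambda>x t. - x t"
  using fermat_rel_mult[OF fermat_rel_const[of "-1"]] by simp
lift_definition minus_fermat :: "fermat \<Rightarrow> fermat \<Rightarrow> fermat" is "\<lambda>x y t. x t - y t"
  using fermat_rel_add[OF _ fermat_rel_mult[OF fermat_rel_const[of "-1"]]] by simp

instance
proof
  fix a b c :: fermat
  show "a + b + c = a + (b + c)"
    by transfer (simp add: fermat_rel_refl_iff algebra_simps little_oh_poly_add)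
  show "a + b = b + a"
    by transfer (simp add: fermat_rel_refl_iff algebra_simps little_oh_poly_add)
  show "0 + a = a" by transfer (simp add: fermat_rel_refl_iff)
  show "- a + a = 0" by transfer (simp add: fermat_rel_refl_iff little_oh_poly_const)
  show "a - b = a + - b"
    by transfer (simp add: fermat_rel_refl_iff little_oh_poly_diff)
  show "a * b * c = a * (b * c)"
    by transfer (simp add: fermat_rel_refl_iff algebra_simps little_oh_poly_mult)
  show "a * b = b * a"
    by transfer (simp add: fermat_rel_refl_iff algebra_simps little_oh_poly_mult)
  show "1 * a = a" by transfer (simp add: fermat_rel_refl_iff)
  show "(a + b) * c = a * c + b * c"
    by transfer (simp add: fermat_rel_refl_iff algebra_simps little_oh_poly_mult little_oh_poly_add)
  have "(\<lambda>t::real. 1::real) \<notin> o[at_right 0](\<lambda>t. t)"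
  proof
    assume *: "(\<lambda>t::real. 1::real) \<in> o[at_right 0](\<lambda>t. t)"
    have "(\<lambda>t::real. t) \<in> o[at_right 0](\<lambda>t. 1::real)" by real_asymp
    from landau_o.small_trans[OF * this] show False
      by (simp add: landau_o.small_refl_iff)
  qed
  thus "(0::fermat) \<noteq> 1" by transfer (simp add: fermat_rel_def)
qed

end

instantiation fermat :: real_algebra_1
begin

lift_definition scaleR_fermat :: "real \<Rightarrow> fermat \<Rightarrow> fermat" is "\<lambda>r x t. r * x t"
  by (rule fermat_rel_mult[OF fermat_rel_const])

instance
proof
  fix a b :: real and x y :: fermat
  show "a *\<^sub>R (x + y) = a *\<^sub>R x + a *\<^sub>R y"
    by transfer (simp add: fermat_rel_refl_iff algebra_simps little_oh_poly_mult little_oh_poly_add little_oh_poly_const)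
  show "(a + b) *\<^sub>R x = a *\<^sub>R x + b *\<^sub>R x"
    by transfer (simp add: fermat_rel_refl_iff algebra_simps little_oh_poly_mult little_oh_poly_add little_oh_poly_const)
  show "a *\<^sub>R b *\<^sub>R x = (a * b) *\<^sub>R x"
    by transfer (simp add: fermat_rel_refl_iff algebra_simps little_oh_poly_mult little_oh_poly_add little_oh_poly_const)
  show "1 *\<^sub>R x = x" by transfer (simp add: fermat_rel_refl_iff)
  show "a *\<^sub>R x * y = a *\<^sub>R (x * y)"
    by transfer (simp add: fermat_rel_refl_iff algebra_simps little_oh_poly_mult little_oh_poly_add little_oh_poly_const)
  show "x * a *\<^sub>R y = a *\<^sub>R (x * y)"
    by transfer (simp add: fermat_rel_refl_iff algebra_simps little_oh_poly_mult little_oh_poly_add little_oh_poly_const)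
qed

end

lemma abs_fermat_eq_iff:
  assumes "little_oh_poly f" "little_oh_poly g"
  shows "abs_fermat f = abs_fermat g \<longleftrightarrow> (\<lambda>t. f t - g t) \<in> o[at_right 0](\<lambda>t. t)"
  using assms Quotient3_rel[OF Quotient3_fermat, of f g] by (auto simp: fermat_rel_def)

lemma rep_fermat_little_oh_poly: "little_oh_poly (rep_fermat x)"
  using Quotient3_rep_reflp[OF Quotient3_fermat] by (simp add: fermat_rel_refl_iff)

lemma abs_rep_fermat: "abs_fermat (rep_fermat x) = x"
  by (rule Quotient3_abs_rep[OF Quotient3_fermat])

lemma rep_abs_fermat:
  "little_oh_poly f \<Longrightarrow> (\<lambda>t. rep_fermat (abs_fermat f) t - f t) \<in> o[at_right 0](\<lambda>t. t)"
  using abs_fermat_eq_iff[OF rep_fermat_little_oh_poly, of f "abs_fermat f"]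
  by (simp add: abs_rep_fermat)

lemma abs_fermat_add:
  "little_oh_poly f \<Longrightarrow> little_oh_poly g \<Longrightarrow>
     abs_fermat f + abs_fermat g = abs_fermat (\<lambda>t. f t + g t)"
  by (intro plus_fermat.abs_eq) (simp_all add: fermat_rel_refl_iff)

lemma abs_fermat_mult:
  "little_oh_poly f \<Longrightarrow> little_oh_poly g \<Longrightarrow>
     abs_fermat f * abs_fermat g = abs_fermat (\<lambda>t. f t * g t)"
  by (intro times_fermat.abs_eq) (simp_all add: fermat_rel_refl_iff)

lemma of_real_fermat: "(of_real r :: fermat) = abs_fermat (\<lambda>_. r)"
  unfolding of_real_def one_fermat_def
  by (subst scaleR_fermat.abs_eq) (simp_all add: fermat_rel_refl_iff little_oh_poly_const)

definition dt :: "real \<Rightarrow> fermat" where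
  "dt a = abs_fermat (\<lambda>t. t powr (1 / a))"


section \<open>The decomposition\<close>

text \<open>
  The list \<open>[(b\<^sub>1,\<beta>\<^sub>1), \<dots>, (b\<^sub>N,\<beta>\<^sub>N)]\<close> holds the coefficients and orders
  of the nonstandard terms.
\<close>

definition is_decomposition :: "fermat \<Rightarrow> real \<Rightarrow> (real \<times> real) list \<Rightarrow> bool" where
  "is_decomposition x r ts \<longleftrightarrow>
     x = of_real r + (\<Sum>(b, \<beta>)\<leftarrow>ts. of_real b * dt \<beta>) \<and>
     (\<forall>(b, \<beta>)\<in>set ts. b \<noteq> 0 \<and> \<beta> \<ge> 1) \<and>
     sorted_wrt (\<lambda>(_, \<beta>) (_, \<beta>'). \<beta> > \<beta>') ts"

definition decomposition :: "fermat \<Rightarrow> real \<times> (real \<times> real) list" where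
  "decomposition x = (THE (r, ts). is_decomposition x r ts)"

definition decomp_fun :: "real \<Rightarrow> (real \<times> real) list \<Rightarrow> real \<Rightarrow> real" where
  "decomp_fun r ts t = r + (\<Sum>(b, \<beta>)\<leftarrow>ts. b * t powr (1 / \<beta>))"

lemma terms_abs_fermat:
  assumes "\<forall>(b, \<beta>)\<in>set ts. \<beta> > 0"
  shows "(\<Sum>(b, \<beta>)\<leftarrow>ts. of_real b * dt \<beta>) = abs_fermat (\<lambda>t. \<Sum>(b, \<beta>)\<leftarrow>ts. b * t powr (1 / \<beta>))
       \<and> is_powr_sum (\<lambda>t. \<Sum>(b, \<beta>)\<leftarrow>ts. b * t powr (1 / \<beta>))"
  using assms
proof (induction ts)
  case Nil
  then show ?case by (simp add: zero_fermat_def is_powr_sum_const)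
next
  case (Cons a ts)
  obtain b \<beta> where a: "a = (b, \<beta>)" by force
  have \<beta>: "\<beta> > 0" using Cons.prems a by auto
  have 1: "of_real b * dt \<beta> = abs_fermat (\<lambda>t. b * t powr (1 / \<beta>))"
    unfolding of_real_fermat dt_def using \<beta>
    by (intro abs_fermat_mult little_oh_poly_const little_oh_poly_powr) auto
  have 2: "is_powr_sum (\<lambda>t. b * t powr (1 / \<beta>))" using \<beta> by (intro is_powr_sum_monom) auto
  have IH: "(\<Sum>(b, \<beta>)\<leftarrow>ts. of_real b * dt \<beta>) = abs_fermat (\<lambda>t. \<Sum>(b, \<beta>)\<leftarrow>ts. b * t powr (1 / \<beta>))"
     "is_powr_sum (\<lambda>t. \<Sum>(b, \<beta>)\<leftarrow>ts. b * t powr (1 / \<beta>))"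
    using Cons by auto
  show ?case
    using IH 1 is_powr_sum_add[OF 2 IH(2)]
      abs_fermat_add[OF little_oh_poly_powr_sum[OF 2] little_oh_poly_powr_sum[OF IH(2)]]
    by (simp add: a)
qed

lemma decomp_fun_powr_sum:
  assumes "\<forall>(b, \<beta>)\<in>set ts. \<beta> > 0"
  shows "is_powr_sum (decomp_fun r ts)"
  unfolding decomp_fun_def using terms_abs_fermat[OF assms]
  by (intro is_powr_sum_add is_powr_sum_const) auto

lemma decomp_fun_abs:
  assumes "\<forall>(b, \<beta>)\<in>set ts. \<beta> > 0"
  shows "of_real r + (\<Sum>(b, \<beta>)\<leftarrow>ts. of_real b * dt \<beta>) = abs_fermat (decomp_fun r ts)"
proof -
  have "decomp_fun r ts = (\<lambda>t. r + (\<Sum>(b, \<beta>)\<leftarrow>ts. b * t powr (1 / \<beta>)))"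
    by (simp add: decomp_fun_def fun_eq_iff)
  with terms_abs_fermat[OF assms] show ?thesis
    by (simp add: of_real_fermat abs_fermat_add little_oh_poly_const little_oh_poly_powr_sum)
qed

lemma is_decomposition_abs:
  assumes "is_decomposition x r ts"
  shows "x = abs_fermat (decomp_fun r ts)"
  using decomp_fun_abs[of ts r] assms unfolding is_decomposition_def by fastforce

lemma small_transform:
  fixes f f' g :: "real \<Rightarrow> real"
  assumes "f \<in> o[F](g)" "eventually (\<lambda>t. f t = f' t) F"
  shows "f' \<in> o[F](g)"
  using landau_o.small.in_cong[OF assms(2), of g] assms(1) by blast

lemma powr_sum_small_imp_zero:
  assumes "finite B" "B \<subseteq> {0..1}" "powr_sum B d \<in> o[at_right 0](\<lambda>t. t)" "\<alpha> \<in> B"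
  shows "d \<alpha> = 0"
proof (rule ccontr)
  assume nz: "d \<alpha> \<noteq> 0"
  define A where "A = {\<alpha>\<in>B. d \<alpha> \<noteq> 0}"
  define m where "m = Min A"
  have A: "finite A" "A \<noteq> {}" "A \<subseteq> {0..1}" using assms nz by (auto simp: A_def)
  have m: "m \<in> A" "\<And>\<alpha>. \<alpha> \<in> A \<Longrightarrow> m \<le> \<alpha>" using A by (auto simp: m_def)
  have eq: "powr_sum B d t = powr_sum A d t" for t
    unfolding powr_sum_def A_def using assms(1) by (intro sum.mono_neutral_right) auto
  have 1: "((\<lambda>t. d \<alpha> * t powr (\<alpha> - m)) \<longlongrightarrow> (if \<alpha> = m then d m else 0)) (at_right 0)"
    if "\<alpha> \<in> A" for \<alpha>
  proof (cases "\<alpha> = m")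
    case True
    have "((\<lambda>t::real. d m * t powr 0) \<longlongrightarrow> d m) (at_right 0)"
    proof (rule Lim_transform_eventually[OF tendsto_const])
      show "\<forall>\<^sub>F t::real in at_right 0. d m = d m * t powr 0"
        using eventually_at_right_less[of "0::real"] by eventually_elim simp
    qed
    with True show ?thesis by simp
  next
    case False
    hence "\<alpha> - m > 0" using m(2)[OF that] by simp
    moreover have "((\<lambda>t::real. t powr e) \<longlongrightarrow> 0) (at_right 0)" if "e > 0" for e
      using that by real_asymp
    ultimately have "((\<lambda>t::real. t powr (\<alpha> - m)) \<longlongrightarrow> 0) (at_right 0)" by blast
    from tendsto_mult_left[OF this, of "d \<alpha>"] False show ?thesis by simp
  qed
  have "((\<lambda>t. \<Sum>\<alpha>\<in>A. d \<alpha> * t powr (\<alpha> - m)) \<longlongrightarrow> (\<Sum>\<alpha>\<in>A. if \<alpha> = m then d m else 0)) (at_right 0)"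
    by (rule tendsto_sum) (rule 1)
  also have "(\<Sum>\<alpha>\<in>A. if \<alpha> = m then d m else 0) = d m" using m A by simp
  finally have lim1: "((\<lambda>t. \<Sum>\<alpha>\<in>A. d \<alpha> * t powr (\<alpha> - m)) \<longlongrightarrow> d m) (at_right 0)" .
  have "(\<lambda>t::real. t) \<in> O[at_right 0](\<lambda>t. t powr m)"
  proof -
    have "m \<le> 1" using m A by auto
    have "\<forall>\<^sub>F t::real in at_right 0. norm t \<le> 1 * norm (t powr m)"
      using eventually_at_right_real[of 0 "1::real", OF zero_less_one]
    proof eventually_elim
      case (elim t)
      have "t powr 1 \<le> t powr m" using elim \<open>m \<le> 1\<close> by (intro powr_mono') auto
      with elim show ?case by simp
    qed
    thus ?thesis by (rule bigoI)
  qed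
  with assms(3) have "powr_sum B d \<in> o[at_right 0](\<lambda>t. t powr m)"
    using landau_o.small_big_trans by blast
  hence "((\<lambda>t. powr_sum B d t / t powr m) \<longlongrightarrow> 0) (at_right 0)"
    by (rule smalloD_tendsto)
  moreover have "eventually (\<lambda>t. powr_sum B d t / t powr m = (\<Sum>\<alpha>\<in>A. d \<alpha> * t powr (\<alpha> - m))) (at_right 0)"
    using eventually_at_right_less[of "0::real"]
  proof eventually_elim
    case (elim t)
    show ?case unfolding eq unfolding powr_sum_def sum_divide_distrib powr_diff by simp
  qed
  ultimately have "((\<lambda>t. \<Sum>\<alpha>\<in>A. d \<alpha> * t powr (\<alpha> - m)) \<longlongrightarrow> 0) (at_right 0)"
    by (rule Lim_transform_eventually)
  with lim1 have "d m = 0" using tendsto_unique[OF trivial_limit_at_right_real] by blast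
  with m show False by (simp add: A_def)
qed

lemma powr_sum_small_iff_tail:
  assumes "finite B" "\<And>\<alpha>. \<alpha> \<in> B \<Longrightarrow> \<alpha> > 1"
  shows "powr_sum B d \<in> o[at_right 0](\<lambda>t. t)"
proof -
  have "(\<lambda>t. d \<alpha> * t powr \<alpha>) \<in> o[at_right 0](\<lambda>t. t)" if "\<alpha> \<in> B" for \<alpha>
  proof -
    have "\<alpha> > 1" using assms that by auto
    hence "(\<lambda>t::real. t powr \<alpha>) \<in> o[at_right 0](\<lambda>t. t)" by real_asymp
    thus ?thesis by (cases "d \<alpha> = 0") auto
  qed
  thus ?thesis unfolding powr_sum_def by (intro big_sum_in_smallo) auto
qed

lemma sorted_wrt_unique:
  assumes "\<And>x y. P x y \<Longrightarrow> \<not> P y x"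
  shows "sorted_wrt P xs \<Longrightarrow> sorted_wrt P ys \<Longrightarrow> set xs = set ys \<Longrightarrow> xs = ys"
proof (induction xs arbitrary: ys)
  case (Cons x xs)
  then obtain y ys' where ys: "ys = y # ys'" by (cases ys) auto
  have xy: "x = y"
  proof (rule ccontr)
    assume "x \<noteq> y"
    hence "x \<in> set ys'" "y \<in> set xs" using Cons.prems ys by auto
    hence "P y x" "P x y" using Cons.prems ys by auto
    thus False using assms by blast
  qed
  have "\<not> P x x" for x using assms by blast
  hence "x \<notin> set xs" "y \<notin> set ys'" using Cons.prems(1,2) ys by auto
  hence "set xs = set ys'" using Cons.prems(3) ys xy by auto
  with Cons ys xy show ?case by auto
qed simp

definition decomp_coeff :: "real \<Rightarrow> (real \<times> real) list \<Rightarrow> real \<Rightarrow> real" where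
  "decomp_coeff r ts \<alpha> = (if \<alpha> = 0 then r else (\<Sum>(b, \<beta>)\<leftarrow>ts. if \<beta> = 1 / \<alpha> then b else 0))"

definition decomp_exps :: "(real \<times> real) list \<Rightarrow> real set" where
  "decomp_exps ts = insert 0 ((\<lambda>(b, \<beta>). 1 / \<beta>) ` set ts)"

lemma decomp_coeff_outside:
  assumes "\<alpha> \<notin> decomp_exps ts"
  shows "decomp_coeff r ts \<alpha> = 0"
  using assms unfolding decomp_coeff_def decomp_exps_def
  by (induction ts) (auto simp: image_iff split: prod.splits)

lemma decomp_coeff_inside:
  assumes "sorted_wrt (\<lambda>(_, \<beta>) (_, \<beta>'). \<beta> > (\<beta>' :: real)) ts" "(b, \<beta>) \<in> set ts" "\<beta> > 0"
  shows "decomp_coeff r ts (1 / \<beta>) = b"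
proof -
  have 0: "(\<Sum>(b, \<beta>')\<leftarrow>ts. if \<beta>' = \<beta> then b else 0) = 0" if "\<forall>(b, \<beta>')\<in>set ts. \<beta>' \<noteq> \<beta>"
    for ts :: "(real \<times> real) list"
    using that by (induction ts) auto
  have "(\<Sum>(b, \<beta>')\<leftarrow>ts. if \<beta>' = \<beta> then b else 0) = b"
    using assms(1,2)
  proof (induction ts)
    case (Cons a ts)
    show ?case
    proof (cases "a = (b, \<beta>)")
      case True
      with Cons.prems have "\<forall>(b, \<beta>')\<in>set ts. \<beta>' \<noteq> \<beta>" by auto
      with 0[of ts] True show ?thesis by simp
    next
      case False
      with Cons show ?thesis by (cases a) auto
    qed
  qed simp
  thus ?thesis using assms(3) by (simp add: decomp_coeff_def)
qed

lemma decomp_fun_eq_powr_sum: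
  assumes "\<forall>(b, \<beta>)\<in>set ts. \<beta> \<ge> 1" "finite B" "decomp_exps ts \<subseteq> B" "t > 0"
  shows "decomp_fun r ts t = powr_sum B (decomp_coeff r ts) t"
  using assms
proof (induction ts)
  case Nil
  have "powr_sum B (decomp_coeff r []) t = (\<Sum>\<alpha>\<in>B. if \<alpha> = 0 then r else 0)"
    unfolding powr_sum_def decomp_coeff_def using \<open>t > 0\<close> by (intro sum.cong) auto
  with Nil show ?case by (simp add: decomp_fun_def decomp_exps_def)
next
  case (Cons a ts)
  obtain b \<beta> where a: "a = (b, \<beta>)" by force
  have \<beta>: "\<beta> \<ge> 1" "1 / \<beta> \<in> B" using Cons.prems by (auto simp: a decomp_exps_def)
  have IH: "decomp_fun r ts t = powr_sum B (decomp_coeff r ts) t"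
    using Cons by (auto simp: decomp_exps_def)
  have "powr_sum B (decomp_coeff r (a # ts)) t
      = (\<Sum>\<alpha>\<in>B. (if \<alpha> = 1 / \<beta> then b * t powr \<alpha> else 0) + decomp_coeff r ts \<alpha> * t powr \<alpha>)"
    unfolding powr_sum_def decomp_coeff_def a using \<beta>
    by (intro sum.cong) (auto simp: algebra_simps)
  also have "\<dots> = b * t powr (1 / \<beta>) + powr_sum B (decomp_coeff r ts) t"
    using \<beta> Cons.prems(2) by (simp add: sum.distrib powr_sum_def)
  finally show ?case using IH by (simp add: decomp_fun_def a)
qed

lemma is_decompositionD:
  assumes "is_decomposition x r ts"
  shows "\<forall>(b, \<beta>)\<in>set ts. \<beta> \<ge> 1" "\<forall>(b, \<beta>)\<in>set ts. b \<noteq> 0"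
    "sorted_wrt (\<lambda>(_, \<beta>) (_, \<beta>'). \<beta> > \<beta>') ts"
proof -
  have *: "\<forall>(b, \<beta>)\<in>set ts. b \<noteq> 0 \<and> \<beta> \<ge> 1"
    using assms unfolding is_decomposition_def by blast
  thus "\<forall>(b, \<beta>)\<in>set ts. \<beta> \<ge> 1" "\<forall>(b, \<beta>)\<in>set ts. b \<noteq> 0" by auto
  show "sorted_wrt (\<lambda>(_, \<beta>) (_, \<beta>'). \<beta> > \<beta>') ts"
    using assms unfolding is_decomposition_def by blast
qed

lemma is_decomposition_unique:
  assumes "is_decomposition x r ts" "is_decomposition x r' ts'"
  shows "r = r' \<and> ts = ts'"
proof -
  define B where "B = decomp_exps ts \<union> decomp_exps ts'"
  have pos: "\<forall>(b, \<beta>)\<in>set ts. \<beta> \<ge> 1" "\<forall>(b, \<beta>)\<in>set ts'. \<beta> \<ge> 1"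
    "\<forall>(b, \<beta>)\<in>set ts. b \<noteq> 0" "\<forall>(b, \<beta>)\<in>set ts'. b \<noteq> 0"
    "sorted_wrt (\<lambda>(_, \<beta>) (_, \<beta>'). \<beta> > \<beta>') ts" "sorted_wrt (\<lambda>(_, \<beta>) (_, \<beta>'). \<beta> > \<beta>') ts'"
    using is_decompositionD assms by blast+
  have pos': "\<forall>(b, \<beta>)\<in>set ts. \<beta> > 0" "\<forall>(b, \<beta>)\<in>set ts'. \<beta> > 0" using pos(1,2) by force+
  have B: "finite B" "B \<subseteq> {0..1}" "decomp_exps ts \<subseteq> B" "decomp_exps ts' \<subseteq> B"
    using pos(1,2) by (auto simp: B_def decomp_exps_def)
  have "abs_fermat (decomp_fun r ts) = abs_fermat (decomp_fun r' ts')"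
    using is_decomposition_abs[OF assms(1)] is_decomposition_abs[OF assms(2)] by (rule subst)
  hence "(\<lambda>t. decomp_fun r ts t - decomp_fun r' ts' t) \<in> o[at_right 0](\<lambda>t. t)"
    using abs_fermat_eq_iff[OF little_oh_poly_powr_sum little_oh_poly_powr_sum,
        OF decomp_fun_powr_sum decomp_fun_powr_sum, OF pos'] by blast
  moreover have "eventually (\<lambda>t. decomp_fun r ts t - decomp_fun r' ts' t
      = powr_sum B (\<lambda>\<alpha>. decomp_coeff r ts \<alpha> - decomp_coeff r' ts' \<alpha>) t) (at_right 0)"
    using eventually_at_right_less[of "0::real"]
  proof eventually_elim
    case (elim t)
    show ?case
      unfolding decomp_fun_eq_powr_sum[OF pos(1) B(1,3) elim] decomp_fun_eq_powr_sum[OF pos(2) B(1,4) elim]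
      by (simp add: powr_sum_def left_diff_distrib sum_subtractf)
  qed
  ultimately have small: "powr_sum B (\<lambda>\<alpha>. decomp_coeff r ts \<alpha> - decomp_coeff r' ts' \<alpha>) \<in> o[at_right 0](\<lambda>t. t)"
    by (rule small_transform)
  have *: "decomp_coeff r ts \<alpha> = decomp_coeff r' ts' \<alpha>" for \<alpha>
  proof (cases "\<alpha> \<in> B")
    case True
    with powr_sum_small_imp_zero[OF B(1,2) small] show ?thesis by simp
  next
    case False
    hence "\<alpha> \<notin> decomp_exps ts" "\<alpha> \<notin> decomp_exps ts'" using B(3,4) by auto
    thus ?thesis by (simp add: decomp_coeff_outside)
  qed
  have r: "r = r'" using *[of 0] by (simp add: decomp_coeff_def)
  have set: "set us = {(b, \<beta>). \<beta> \<ge> 1 \<and> b \<noteq> 0 \<and> b = decomp_coeff q us (1 / \<beta>)}"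
    if "\<forall>(b, \<beta>)\<in>set us. \<beta> \<ge> 1" "\<forall>(b, \<beta>)\<in>set us. b \<noteq> 0"
       "sorted_wrt (\<lambda>(_, \<beta>) (_, \<beta>'). \<beta> > \<beta>') us" for us q
  proof (intro set_eqI, clarify, intro iffI)
    fix b \<beta> assume "(b, \<beta>) \<in> set us"
    thus "(b, \<beta>) \<in> {(b, \<beta>). \<beta> \<ge> 1 \<and> b \<noteq> 0 \<and> b = decomp_coeff q us (1 / \<beta>)}"
      using that(1,2) decomp_coeff_inside[OF that(3), of b \<beta> q] by fastforce
  next
    fix b \<beta> assume *: "(b, \<beta>) \<in> {(b, \<beta>). \<beta> \<ge> 1 \<and> b \<noteq> 0 \<and> b = decomp_coeff q us (1 / \<beta>)}"
    hence "1 / \<beta> \<in> decomp_exps us" using decomp_coeff_outside[of "1 / \<beta>" us q] by force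
    with * obtain b' where b': "(b', \<beta>) \<in> set us" by (auto simp: decomp_exps_def)
    with decomp_coeff_inside[OF that(3) b', of q] * show "(b, \<beta>) \<in> set us" by simp
  qed
  have "set ts = {(b, \<beta>). \<beta> \<ge> 1 \<and> b \<noteq> 0 \<and> b = decomp_coeff r ts (1 / \<beta>)}"
    by (rule set[OF pos(1,3,5)])
  also have "\<dots> = {(b, \<beta>). \<beta> \<ge> 1 \<and> b \<noteq> 0 \<and> b = decomp_coeff r' ts' (1 / \<beta>)}"
    by (simp only: *)
  also have "\<dots> = set ts'"
    by (rule set[OF pos(2,4,6), symmetric])
  finally have "set ts = set ts'" .
  hence "ts = ts'"
    by (rule sorted_wrt_unique[OF _ pos(5,6), rotated]) auto
  with r show ?thesis by simp
qed

lemma is_decomposition_exists: "\<exists>r ts. is_decomposition x r ts"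
proof -
  obtain f where f: "is_powr_sum f" "(\<lambda>t. rep_fermat x t - f t) \<in> o[at_right 0](\<lambda>t. t)"
    using rep_fermat_little_oh_poly[of x] little_oh_poly_iff by blast
  then obtain A c where A: "finite A" "A \<subseteq> {0..}" "\<And>t. t > 0 \<Longrightarrow> f t = powr_sum A c t"
    unfolding is_powr_sum_def by auto
  define E where "E = {\<alpha>\<in>A. 0 < \<alpha> \<and> \<alpha> \<le> 1 \<and> c \<alpha> \<noteq> 0}"
  define l where "l = sorted_list_of_set E"
  define r where "r = (if 0 \<in> A then c 0 else 0)"
  define ts where "ts = map (\<lambda>\<alpha>. (c \<alpha>, 1 / \<alpha>)) l"
  have E: "finite E" using A by (auto simp: E_def)
  have l: "set l = E" "distinct l" "sorted_wrt (<) l" using E by (auto simp: l_def)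
  have ts: "\<forall>(b, \<beta>)\<in>set ts. b \<noteq> 0 \<and> \<beta> \<ge> 1" using l(1) by (auto simp: ts_def E_def)
  hence ts': "\<forall>(b, \<beta>)\<in>set ts. \<beta> > 0" by force
  have "sorted_wrt (\<lambda>\<alpha> \<alpha>'. 1 / \<alpha> > 1 / \<alpha>') l"
    using l(3)
  proof (rule sorted_wrt_mono_rel[rotated])
    fix \<alpha> \<alpha>' assume "\<alpha> \<in> set l" "\<alpha>' \<in> set l" "\<alpha> < \<alpha>'"
    thus "1 / \<alpha> > 1 / \<alpha>'" unfolding l(1) E_def by (intro divide_strict_left_mono) auto
  qed
  hence sorted: "sorted_wrt (\<lambda>(_, \<beta>) (_, \<beta>'). \<beta> > \<beta>') ts"
    by (simp add: ts_def sorted_wrt_map)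
  have fun_ts: "decomp_fun r ts t = r + powr_sum E c t" for t
    using sum_list_distinct_conv_sum_set[OF l(2), of "\<lambda>\<alpha>. c \<alpha> * t powr \<alpha>"]
    by (simp add: decomp_fun_def ts_def powr_sum_def l(1) o_def)
  define T where "T = {\<alpha>\<in>A. \<alpha> > 1}"
  have split: "powr_sum A c t = (r + powr_sum E c t) + powr_sum T c t" if "t > 0" for t
  proof -
    have "powr_sum A c t = powr_sum (A \<inter> {0}) c t + powr_sum (A \<inter> {0<..1}) c t + powr_sum T c t"
    proof -
      have "A = (A \<inter> {0} \<union> A \<inter> {0<..1}) \<union> T" using A(2) by (auto simp: T_def)
      hence "powr_sum A c t = powr_sum ((A \<inter> {0} \<union> A \<inter> {0<..1}) \<union> T) c t" by simp
      also have "\<dots> = powr_sum (A \<inter> {0} \<union> A \<inter> {0<..1}) c t + powr_sum T c t"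
        unfolding powr_sum_def using A(1) by (intro sum.union_disjoint) (auto simp: T_def)
      also have "powr_sum (A \<inter> {0} \<union> A \<inter> {0<..1}) c t
          = powr_sum (A \<inter> {0}) c t + powr_sum (A \<inter> {0<..1}) c t"
        unfolding powr_sum_def using A(1) by (intro sum.union_disjoint) auto
      finally show ?thesis .
    qed
    moreover have "powr_sum (A \<inter> {0}) c t = r" using that by (simp add: r_def powr_sum_def)
    moreover have "powr_sum (A \<inter> {0<..1}) c t = powr_sum E c t"
      unfolding powr_sum_def using A(1) by (intro sum.mono_neutral_right) (auto simp: E_def)
    ultimately show ?thesis by simp
  qed
  have "powr_sum T c \<in> o[at_right 0](\<lambda>t. t)"
    using A(1) by (intro powr_sum_small_iff_tail) (auto simp: T_def)
  with f(2) have "(\<lambda>t. (rep_fermat x t - f t) + powr_sum T c t) \<in> o[at_right 0](\<lambda>t. t)"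
    by (intro sum_in_smallo(1)) auto
  moreover have "eventually (\<lambda>t. (rep_fermat x t - f t) + powr_sum T c t
      = rep_fermat x t - decomp_fun r ts t) (at_right 0)"
    using eventually_at_right_less[of "0::real"]
    by eventually_elim (simp add: A(3) split fun_ts)
  ultimately have "(\<lambda>t. rep_fermat x t - decomp_fun r ts t) \<in> o[at_right 0](\<lambda>t. t)"
    by (rule small_transform)
  hence "abs_fermat (rep_fermat x) = abs_fermat (decomp_fun r ts)"
    by (subst abs_fermat_eq_iff)
       (auto intro: rep_fermat_little_oh_poly little_oh_poly_powr_sum decomp_fun_powr_sum[OF ts'])
  hence "is_decomposition x r ts"
    using ts sorted unfolding is_decomposition_def decomp_fun_abs[OF ts']
    by (simp add: abs_rep_fermat)
  thus ?thesis by blast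
qed

lemma decomposition_eq_iff: "decomposition x = (r, ts) \<longleftrightarrow> is_decomposition x r ts"
proof -
  obtain r' ts' where *: "is_decomposition x r' ts'" using is_decomposition_exists by blast
  have "decomposition x = (r', ts')"
    unfolding decomposition_def
    by (rule the_equality) (use * is_decomposition_unique in auto)
  with * is_decomposition_unique show ?thesis by auto
qed

definition std_part :: "fermat \<Rightarrow> real" where
  "std_part x = fst (decomposition x)"

definition num_terms :: "fermat \<Rightarrow> nat" where
  "num_terms x = length (snd (decomposition x))"

text \<open>Terms are counted from \<open>1\<close>, lists from \<open>0\<close>.\<close>

definition term_coeff :: "fermat \<Rightarrow> nat \<Rightarrow> real" where
  "term_coeff x j = fst (snd (decomposition x) ! (j - 1))"

definition term_order :: "fermat \<Rightarrow> nat \<Rightarrow> real" where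
  "term_order x j = snd (snd (decomposition x) ! (j - 1))"

definition D_infty :: "fermat set" where
  "D_infty = {x. std_part x = 0}"

definition pos_infinitesimal :: "fermat \<Rightarrow> bool" where
  "pos_infinitesimal x \<longleftrightarrow> x \<in> D_infty \<and> x \<noteq> 0 \<and> term_coeff x 1 > 0"


section \<open>Powers\<close>

text \<open>
  On \<^typ>\<open>ereal\<close>, \<open>inverse \<infinity> = 0\<close> and \<open>inverse 0 = \<infinity>\<close>; hence also
  \<open>a / 0 = \<infinity>\<close> for \<open>a > 0\<close>.
\<close>

definition harm_add :: "ereal \<Rightarrow> ereal \<Rightarrow> ereal" (infixl \<open>\<oplus>\<close> 65) where
  "a \<oplus> b = inverse (inverse a + inverse b)"

definition harm_diff :: "ereal \<Rightarrow> ereal \<Rightarrow> ereal" (infixl \<open>\<ominus>\<close> 65) where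
  "a \<ominus> b = inverse (inverse a - inverse b)"

definition harm_sum :: "(nat \<Rightarrow> ereal) \<Rightarrow> nat set \<Rightarrow> ereal" where
  "harm_sum f J = inverse (\<Sum>j\<in>J. inverse (f j))"

text \<open>
  The power for \<open>std_part y > 0\<close>; \<open>powr_std_pos_abs\<close> below shows that it does not
  depend on the chosen representative.
\<close>

definition powr_std_pos :: "fermat \<Rightarrow> real \<Rightarrow> fermat" where
  "powr_std_pos y p = abs_fermat (\<lambda>t. rep_fermat y t powr p)"

definition powr_inf :: "fermat \<Rightarrow> real \<Rightarrow> fermat" where
  "powr_inf c p =
     of_real (term_coeff c 1 powr p) * dt (term_order c 1 / p) *
     powr_std_pos
       (1 + (\<Sum>j=2..num_terms c. of_real (term_coeff c j / term_coeff c 1) *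
               dt (real_of_ereal (ereal (term_order c j) \<ominus> ereal (term_order c 1))))) p"

definition fpowr :: "fermat \<Rightarrow> real \<Rightarrow> fermat" where
  "fpowr y p =
     (if std_part y > 0 then powr_std_pos y p
      else if pos_infinitesimal y then powr_inf y p
      else undefined)"

lemma powr_lipschitz:
  fixes r p :: real
  assumes "r > 0"
  obtains C where "C > 0"
    "\<And>u v. u \<in> {r/2..2*r} \<Longrightarrow> v \<in> {r/2..2*r} \<Longrightarrow> \<bar>u powr p - v powr p\<bar> \<le> C * \<bar>u - v\<bar>"
proof -
  have "continuous_on {r/2..2*r} (\<lambda>u. p * u powr (p - 1))"
    using assms by (intro continuous_intros) auto
  hence "bounded ((\<lambda>u. p * u powr (p - 1)) ` {r/2..2*r})"
    by (intro compact_imp_bounded compact_continuous_image) auto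
  then obtain C where C: "C > 0" "\<And>u. u \<in> {r/2..2*r} \<Longrightarrow> norm (p * u powr (p - 1)) \<le> C"
    unfolding bounded_pos by auto
  have "norm (u powr p - v powr p) \<le> C * norm (u - v)" if "u \<in> {r/2..2*r}" "v \<in> {r/2..2*r}" for u v
  proof (rule field_differentiable_bound[of "{r/2..2*r}" "\<lambda>u. u powr p" "\<lambda>u. p * u powr (p - 1)"])
    fix z assume z: "z \<in> {r/2..2*r}"
    thus "((\<lambda>u. u powr p) has_field_derivative p * z powr (p - 1)) (at z within {r/2..2*r})"
      using assms by (auto intro!: derivative_eq_intros)
  qed (use that C in auto)
  with C(1) that show ?thesis by auto
qed

lemma powr_taylor:
  fixes r p :: real
  assumes "r > 0" "M > 0"
  obtains a :: "nat \<Rightarrow> real" and C where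
    "\<And>z. \<bar>z\<bar> \<le> r / 2 \<Longrightarrow> \<bar>(r + z) powr p - (\<Sum>m<M. a m * z ^ m)\<bar> \<le> C * \<bar>z\<bar> ^ M"
proof -
  define diff where "diff = (\<lambda>m u. (\<Prod>i<m. p - real i) * u powr (p - real m))"
  have "continuous_on {r/2..2*r} (diff M)"
    unfolding diff_def using assms by (intro continuous_intros) auto
  hence "bounded (diff M ` {r/2..2*r})"
    by (intro compact_imp_bounded compact_continuous_image) auto
  then obtain C where C: "C > 0" "\<And>u. u \<in> {r/2..2*r} \<Longrightarrow> norm (diff M u) \<le> C"
    unfolding bounded_pos by auto
  have "\<bar>(r + z) powr p - (\<Sum>m<M. diff m r / fact m * z ^ m)\<bar> \<le> C * \<bar>z\<bar> ^ M"
    if z: "\<bar>z\<bar> \<le> r / 2" for z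
  proof (cases "z = 0")
    case True
    have "(\<Sum>m<M. diff m r / fact m * 0 ^ m) = r powr p"
      using assms by (cases M) (simp_all add: sum.lessThan_Suc_shift diff_def)
    with True assms show ?thesis by (simp add: power_0_left)
  next
    case False
    have "\<exists>t. (if r + z < r then r + z < t \<and> t < r else r < t \<and> t < r + z) \<and>
       (r + z) powr p = (\<Sum>m<M. (diff m r / fact m) * (r + z - r)^m) + (diff M t / fact M) * (r + z - r)^M"
    proof (rule Taylor[of M diff "\<lambda>u. u powr p" "r/2" "2*r"])
      show "\<forall>m t. m < M \<and> r/2 \<le> t \<and> t \<le> 2*r \<longrightarrow> (diff m has_real_derivative diff (Suc m) t) (at t)"
        using assms unfolding diff_def
        by (auto intro!: derivative_eq_intros simp: algebra_simps)
      show "r/2 \<le> r + z" "r + z \<le> 2*r"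
        using z assms by (auto simp: abs_le_iff field_simps)
    qed (use assms False in \<open>auto simp: diff_def\<close>)
    then obtain t where t: "if r + z < r then r + z < t \<and> t < r else r < t \<and> t < r + z"
       "(r + z) powr p = (\<Sum>m<M. (diff m r / fact m) * z^m) + (diff M t / fact M) * z^M"
      by auto
    have "t \<in> {r/2..2*r}" using t(1) z assms by (auto split: if_splits simp: abs_le_iff)
    hence "\<bar>diff M t\<bar> \<le> C" using C by auto
    hence "\<bar>diff M t / fact M\<bar> \<le> C / 1" unfolding abs_divide
      using C(1) by (intro frac_le) (auto simp: fact_ge_1)
    hence "\<bar>diff M t / fact M * z ^ M\<bar> \<le> C * \<bar>z\<bar> ^ M"
      unfolding abs_mult power_abs by (intro mult_right_mono) auto
    thus ?thesis by (simp add: t(2))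
  qed
  thus ?thesis using that[of "\<lambda>m. diff m r / fact m" C] by blast
qed

lemma decomp_terms_bound:
  fixes ts :: "(real \<times> real) list"
  assumes "\<forall>(b, \<beta>)\<in>set ts. \<beta> > 0"
  shows "\<exists>\<epsilon>>0. (\<lambda>t. \<Sum>(b, \<beta>)\<leftarrow>ts. b * t powr (1 / \<beta>)) \<in> O[at_right 0](\<lambda>t. t powr \<epsilon>)"
  using assms
proof (induction ts)
  case Nil
  show ?case by (intro exI[of _ 1]) simp
next
  case (Cons a ts)
  obtain b \<beta> where a: "a = (b, \<beta>)" by force
  obtain \<epsilon> where \<epsilon>: "\<epsilon> > 0" "(\<lambda>t. \<Sum>(b, \<beta>)\<leftarrow>ts. b * t powr (1 / \<beta>)) \<in> O[at_right 0](\<lambda>t. t powr \<epsilon>)"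
    using Cons by auto
  have \<beta>: "\<beta> > 0" using Cons.prems a by auto
  define \<delta> where "\<delta> = min \<epsilon> (1 / \<beta>)"
  have le: "(\<lambda>t::real. t powr \<gamma>) \<in> O[at_right 0](\<lambda>t. t powr \<delta>)" if "\<gamma> \<ge> \<delta>" for \<gamma>
  proof (rule bigoI[of _ 1])
    show "\<forall>\<^sub>F t::real in at_right 0. norm (t powr \<gamma>) \<le> 1 * norm (t powr \<delta>)"
      using eventually_at_right_real[of 0 "1::real", OF zero_less_one]
    proof eventually_elim
      case (elim t)
      have "t powr \<gamma> \<le> t powr \<delta>" using elim that by (intro powr_mono') auto
      thus ?case by simp
    qed
  qed
  have "(\<lambda>t. \<Sum>(b, \<beta>)\<leftarrow>ts. b * t powr (1 / \<beta>)) \<in> O[at_right 0](\<lambda>t. t powr \<delta>)"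
    using \<epsilon>(2) le[of \<epsilon>] landau_o.big_trans unfolding \<delta>_def by force
  moreover have "(\<lambda>t. b * t powr (1 / \<beta>)) \<in> O[at_right 0](\<lambda>t. t powr \<delta>)"
    using le[of "1 / \<beta>"] by (cases "b = 0") (auto simp: \<delta>_def)
  ultimately have "(\<lambda>t. b * t powr (1 / \<beta>) + (\<Sum>(b, \<beta>)\<leftarrow>ts. b * t powr (1 / \<beta>)))
      \<in> O[at_right 0](\<lambda>t. t powr \<delta>)"
    by (intro sum_in_bigo(1))
  moreover have "\<delta> > 0" using \<epsilon> \<beta> by (simp add: \<delta>_def)
  ultimately show ?case by (intro exI[of _ \<delta>]) (simp add: a)
qed

lemma is_powr_sum_power: "is_powr_sum f \<Longrightarrow> is_powr_sum (\<lambda>t. f t ^ n)"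
  by (induction n) (auto intro: is_powr_sum_const is_powr_sum_mult)

lemma powr_little_oh_poly:
  assumes ts: "\<forall>(b, \<beta>)\<in>set ts. \<beta> > 0" and r: "r > 0"
    and f: "(\<lambda>t. f t - decomp_fun r ts t) \<in> o[at_right 0](\<lambda>t. t)"
  shows "little_oh_poly (\<lambda>t. f t powr p)"
    and "(\<lambda>t. f t powr p - decomp_fun r ts t powr p) \<in> o[at_right 0](\<lambda>t. t)"
proof -
  define h where "h = (\<lambda>t. \<Sum>(b, \<beta>)\<leftarrow>ts. b * t powr (1 / \<beta>))"
  have P: "decomp_fun r ts t = r + h t" for t by (simp add: decomp_fun_def h_def)
  have h: "is_powr_sum h" using terms_abs_fermat[OF ts] by (simp add: h_def)
  obtain \<epsilon> where \<epsilon>: "\<epsilon> > 0" "h \<in> O[at_right 0](\<lambda>t. t powr \<epsilon>)"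
    using decomp_terms_bound[OF ts] unfolding h_def by auto
  have "(\<lambda>t::real. t powr \<epsilon>) \<in> o[at_right 0](\<lambda>_. 1)" using \<epsilon>(1) by real_asymp
  with \<epsilon>(2) have "h \<in> o[at_right 0](\<lambda>_. 1)" by (rule landau_o.big_small_trans)
  hence h0: "(h \<longlongrightarrow> 0) (at_right 0)" using smalloD_tendsto by fastforce
  have "(\<lambda>t::real. t) \<in> o[at_right 0](\<lambda>_. 1)" by real_asymp
  with f have "(\<lambda>t. f t - decomp_fun r ts t) \<in> o[at_right 0](\<lambda>_. 1)"
    by (rule landau_o.small_trans)
  hence fP0: "((\<lambda>t. f t - decomp_fun r ts t) \<longlongrightarrow> 0) (at_right 0)" using smalloD_tendsto by fastforce
  have Plim: "(decomp_fun r ts \<longlongrightarrow> r) (at_right 0)"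
    using tendsto_add[OF tendsto_const[of r] h0] by (simp add: P[abs_def])
  have flim: "(f \<longlongrightarrow> r) (at_right 0)"
    using tendsto_add[OF fP0 Plim] by simp
  have ev: "eventually (\<lambda>t. g t \<in> {r/2..2*r}) (at_right 0)" if "(g \<longlongrightarrow> r) (at_right 0)" for g :: "real \<Rightarrow> real"
    using order_tendstoD(1)[OF that, of "r/2"] order_tendstoD(2)[OF that, of "2*r"] r
    by (auto elim: eventually_elim2)
  obtain C where C: "C > 0"
    "\<And>u v. u \<in> {r/2..2*r} \<Longrightarrow> v \<in> {r/2..2*r} \<Longrightarrow> \<bar>u powr p - v powr p\<bar> \<le> C * \<bar>u - v\<bar>"
    using powr_lipschitz[OF r, of p] by blast
  have "(\<lambda>t. f t powr p - decomp_fun r ts t powr p) \<in> O[at_right 0](\<lambda>t. f t - decomp_fun r ts t)"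
  proof (rule bigoI[of _ C])
    show "\<forall>\<^sub>F t in at_right 0. norm (f t powr p - decomp_fun r ts t powr p)
            \<le> C * norm (f t - decomp_fun r ts t)"
      using ev[OF flim] ev[OF Plim] by eventually_elim (simp only: real_norm_def C(2))
  qed
  thus A: "(\<lambda>t. f t powr p - decomp_fun r ts t powr p) \<in> o[at_right 0](\<lambda>t. t)"
    using f landau_o.big_small_trans by blast
  obtain M where M: "real M * \<epsilon> > 1" using \<epsilon>(1) reals_Archimedean3 by blast
  have "M > 0" using M by (cases M) auto
  obtain a :: "nat \<Rightarrow> real" and K where K:
    "\<And>z. \<bar>z\<bar> \<le> r / 2 \<Longrightarrow> \<bar>(r + z) powr p - (\<Sum>m<M. a m * z ^ m)\<bar> \<le> K * \<bar>z\<bar> ^ M"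
    using powr_taylor[OF r \<open>M > 0\<close>, of p] by blast
  have "eventually (\<lambda>t. \<bar>h t\<bar> \<le> r / 2) (at_right 0)"
    using order_tendstoD(1)[OF h0, of "-r/2"] order_tendstoD(2)[OF h0, of "r/2"] r
    by (auto elim: eventually_elim2)
  hence "\<forall>\<^sub>F t in at_right 0. norm (decomp_fun r ts t powr p - (\<Sum>m<M. a m * h t ^ m))
            \<le> K * norm (h t ^ M)"
    by eventually_elim (simp only: P real_norm_def power_abs K)
  hence "(\<lambda>t. decomp_fun r ts t powr p - (\<Sum>m<M. a m * h t ^ m)) \<in> O[at_right 0](\<lambda>t. h t ^ M)"
    by (rule bigoI)
  also have "(\<lambda>t. h t ^ M) \<in> O[at_right 0](\<lambda>t. (t powr \<epsilon>) ^ M)"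
    by (rule landau_o.big_power[OF \<epsilon>(2)])
  also have "(\<lambda>t::real. (t powr \<epsilon>) ^ M) \<in> o[at_right 0](\<lambda>t. t)"
  proof -
    have "(\<lambda>t::real. t powr (real M * \<epsilon>)) \<in> o[at_right 0](\<lambda>t. t)" using M by real_asymp
    moreover have "eventually (\<lambda>t::real. t powr (real M * \<epsilon>) = (t powr \<epsilon>) ^ M) (at_right 0)"
      using eventually_at_right_less[of "0::real"]
      by eventually_elim (simp add: powr_realpow[symmetric] powr_powr mult_ac)
    ultimately show ?thesis by (rule small_transform)
  qed
  finally have B: "(\<lambda>t. decomp_fun r ts t powr p - (\<Sum>m<M. a m * h t ^ m)) \<in> o[at_right 0](\<lambda>t. t)" .
  have "(\<lambda>t. f t powr p - (\<Sum>m<M. a m * h t ^ m)) \<in> o[at_right 0](\<lambda>t. t)"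
    using sum_in_smallo(1)[OF A B] by simp
  moreover have "is_powr_sum (\<lambda>t. \<Sum>m<M. a m * h t ^ m)"
    using h by (intro is_powr_sum_sum is_powr_sum_mult is_powr_sum_const is_powr_sum_power)
  ultimately show "little_oh_poly (\<lambda>t. f t powr p)" unfolding little_oh_poly_iff by blast
qed

lemma powr_std_pos_abs:
  assumes f: "little_oh_poly f" and pos: "std_part (abs_fermat f) > 0"
  shows "little_oh_poly (\<lambda>t. f t powr p)"
    and "powr_std_pos (abs_fermat f) p = abs_fermat (\<lambda>t. f t powr p)"
proof -
  define x where "x = abs_fermat f"
  obtain r ts where d: "decomposition x = (r, ts)" by force
  have r: "r > 0" using pos d by (simp add: std_part_def x_def)
  have dec: "is_decomposition x r ts" using d by (simp add: decomposition_eq_iff)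
  have ts: "\<forall>(b, \<beta>)\<in>set ts. \<beta> > 0" using dec unfolding is_decomposition_def by fastforce
  have x: "x = abs_fermat (decomp_fun r ts)" by (rule is_decomposition_abs[OF dec])
  have lP: "little_oh_poly (decomp_fun r ts)"
    by (intro little_oh_poly_powr_sum decomp_fun_powr_sum ts)
  have 1: "(\<lambda>t. f t - decomp_fun r ts t) \<in> o[at_right 0](\<lambda>t. t)"
    using x abs_fermat_eq_iff[OF f lP] by (simp add: x_def)
  have 2: "(\<lambda>t. rep_fermat x t - decomp_fun r ts t) \<in> o[at_right 0](\<lambda>t. t)"
    using x rep_abs_fermat[OF lP] by simp
  note A = powr_little_oh_poly[OF ts r 1, of p]
  note B = powr_little_oh_poly[OF ts r 2, of p]
  show "little_oh_poly (\<lambda>t. f t powr p)" by (rule A)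
  have "(\<lambda>t. rep_fermat x t powr p - f t powr p) \<in> o[at_right 0](\<lambda>t. t)"
    using sum_in_smallo(2)[OF B(2) A(2)] by simp
  thus "powr_std_pos (abs_fermat f) p = abs_fermat (\<lambda>t. f t powr p)"
    unfolding powr_std_pos_def x_def[symmetric] using A B by (simp add: abs_fermat_eq_iff)
qed


section \<open>Loss of information and completeness\<close>

text \<open>
  A multi-index in \<open>\<nat>\<^bsup>N-1\<^esup>\<close> is a function on \<open>nat\<close> of which only the values at
  \<open>1, \<dots>, N - 1\<close> are used.
\<close>

definition omega :: "fermat \<Rightarrow> (nat \<Rightarrow> nat) \<Rightarrow> ereal" where
  "omega x \<gamma> = harm_sum
     (\<lambda>j. (ereal (term_order x j) \<ominus> ereal (term_order x 1)) / ereal (real (\<gamma> (j - 1)))) {2..num_terms x}"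

definition k_bound :: "fermat \<Rightarrow> real \<Rightarrow> real" where
  "k_bound x s =
     (let m = of_int \<lceil>real_of_ereal (ereal (term_order x 2) \<ominus> ereal (term_order x 1))\<rceil>
      in if s \<in> \<nat> then min m s else m)"

definition loses_information :: "fermat \<Rightarrow> real \<Rightarrow> nat \<Rightarrow> bool" where
  "loses_information x s r \<longleftrightarrow>
     (if r = 1 then term_order x 1 < s
      else \<exists>(n::nat) (\<gamma>::nat \<Rightarrow> nat).
             1 \<le> n \<and> real n \<le> k_bound x s \<and>
             (\<Sum>i=1..num_terms x - 1. \<gamma> i) = n \<and> \<gamma> (r - 1) \<noteq> 0 \<and>
             omega x \<gamma> \<oplus> ereal (term_order x 1 / s) < 1)"

definition all_terms_complete :: "fermat \<Rightarrow> real \<Rightarrow> bool" where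
  "all_terms_complete x s \<longleftrightarrow> (\<forall>r\<in>{1..num_terms x}. \<not> loses_information x s r)"

text \<open>
  For \<open>p > 1\<close> the map \<open>x \<mapsto> x\<^sup>p\<close> is not injective on the set of positive infinitesimals
  that are complete with respect to \<open>x\<^bsup>1/p\<^esup>\<close>: it sends all \<open>b dt\<^sub>1\<close> with \<open>b > 0\<close> to
  \<open>b\<^sup>p dt\<^bsub>1/p\<^esub> = 0\<close>.
\<close>

lemma dt_eq_0: "0 < a \<Longrightarrow> a < 1 \<Longrightarrow> dt a = 0"
proof -
  assume a: "0 < a" "a < 1"
  define q where "q = 1 / a"
  have "q > 1" using a by (simp add: q_def)
  hence "(\<lambda>t::real. t powr q) \<in> o[at_right 0](\<lambda>t. t)" by real_asymp
  moreover have "little_oh_poly (\<lambda>t. t powr q)" using \<open>q > 1\<close> by (intro little_oh_poly_powr) auto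
  ultimately show "dt a = 0"
    unfolding dt_def zero_fermat_def q_def[symmetric]
    by (subst abs_fermat_eq_iff) (auto intro: little_oh_poly_const)
qed

lemma fpowr_not_inj:
  assumes "p > 1"
  shows "\<not> inj_on (\<lambda>x. fpowr x p)
           ({x \<in> D_infty. pos_infinitesimal x \<and> all_terms_complete x (1 / p)} \<union> {y. std_part y > 0})"
proof
  define X where "X = (\<lambda>b. of_real b * dt 1)"
  have dec: "decomposition (X b) = (0, [(b, 1)])" if "b > 0" for b
    unfolding decomposition_eq_iff using that by (simp add: is_decomposition_def X_def)
  have dec0: "decomposition 0 = (0, [])"
    unfolding decomposition_eq_iff by (simp add: is_decomposition_def)
  have mem: "X b \<in> {x \<in> D_infty. pos_infinitesimal x \<and> all_terms_complete x (1 / p)} \<union> {y. std_part y > 0}"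
    and zero: "fpowr (X b) p = 0" if "b > 0" for b
  proof -
    note [simp] = dec[OF that]
    have nz: "X b \<noteq> 0"
    proof
      assume "X b = 0"
      with dec[OF that] dec0 show False by simp
    qed
    have pos: "pos_infinitesimal (X b)"
      using that nz by (simp add: pos_infinitesimal_def D_infty_def std_part_def term_coeff_def)
    have "all_terms_complete (X b) (1 / p)"
      using assms by (simp add: all_terms_complete_def loses_information_def num_terms_def term_order_def)
    with pos show "X b \<in> {x \<in> D_infty. pos_infinitesimal x \<and> all_terms_complete x (1 / p)} \<union> {y. std_part y > 0}"
      by (simp add: pos_infinitesimal_def)
    have "dt (term_order (X b) 1 / p) = 0"
      using assms by (intro dt_eq_0) (simp_all add: term_order_def)
    with pos show "fpowr (X b) p = 0"
      by (simp add: fpowr_def powr_inf_def std_part_def)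
  qed
  assume "inj_on (\<lambda>x. fpowr x p)
           ({x \<in> D_infty. pos_infinitesimal x \<and> all_terms_complete x (1 / p)} \<union> {y. std_part y > 0})"
  from inj_onD[OF this, of "X 1" "X 2"] have "X 1 = X 2"
    using mem[of 1] mem[of 2] zero[of 1] zero[of 2] by simp
  with dec[of 1] dec[of 2] show False by simp
qed

end

theory Submission
  imports Defs
begin

text \<open>
  The map \<open>x \<mapsto> x\<^bsup>1/p\<^esup>\<close> has the left inverse \<open>y \<mapsto> y\<^sup>p\<close>. For a positive infinitesimal \<open>x\<close>
  with decomposition function \<open>f\<close>, the power \<open>x\<^sup>s\<close> is the class of \<open>f\<^sup>s\<close>; the point is that
  the second power is computed from the truncation \<open>g\<close> of \<open>f\<^sup>s\<close> to exponents \<open>\<le> 1\<close>.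
  Completeness forces \<open>g = f\<^sup>s\<close>: testing a multi-index \<open>(k, 0, \<dots>, 0)\<close> with \<open>k\<close> the upper
  bound \<open>\<lceil>\<beta>\<^sub>2 \<ominus> \<beta>\<^sub>1\<rceil>\<close> always produces a lost term, so \<open>x\<close> has a single term or
  \<open>s\<close> is a natural number, and in the latter case the multi-indices \<open>(0, \<dots>, s, \<dots>, 0)\<close>
  show that all exponents of \<open>f\<^sup>s\<close> are \<open>\<le> 1\<close>. For \<open>q \<ge> 1\<close> no completeness is needed, because
  \<open>u \<mapsto> u\<^sup>q\<close> is Lipschitz on \<open>[0, 1]\<close> and hence insensitive to the truncation; this gives
  injectivity of \<open>x \<mapsto> x\<^sup>p\<close> for \<open>p \<le> 1\<close>, with left inverse \<open>y \<mapsto> y\<^bsup>1/p\<^esup>\<close>.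
\<close>

section \<open>Limits of representatives and the standard part\<close>

lemma small_id_tendsto_0:
  fixes f :: "real \<Rightarrow> real"
  assumes "f \<in> o[at_right 0](\<lambda>t. t)"
  shows "(f \<longlongrightarrow> 0) (at_right 0)"
proof -
  have "(\<lambda>t::real. t) \<in> o[at_right 0](\<lambda>_. 1)" by real_asymp
  with assms have "f \<in> o[at_right 0](\<lambda>_. 1)" by (rule landau_o.small_trans)
  thus ?thesis using smalloD_tendsto by fastforce
qed

lemma abs_fermat_cong:
  assumes f: "little_oh_poly f" and eq: "eventually (\<lambda>t. f t = g t) (at_right 0)"
  shows "little_oh_poly g" "abs_fermat f = abs_fermat g"
proof -
  obtain h where h: "is_powr_sum h" "(\<lambda>t. f t - h t) \<in> o[at_right 0](\<lambda>t. t)"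
    using f little_oh_poly_iff by auto
  have "eventually (\<lambda>t. f t - h t = g t - h t) (at_right 0)"
    using eq by eventually_elim simp
  from small_transform[OF h(2) this] h(1) show g: "little_oh_poly g"
    unfolding little_oh_poly_iff by blast
  have "(\<lambda>_. 0) \<in> o[at_right 0](\<lambda>t::real. t)" by simp
  moreover have "eventually (\<lambda>t. 0 = f t - g t) (at_right 0)"
    using eq by eventually_elim simp
  ultimately have "(\<lambda>t. f t - g t) \<in> o[at_right 0](\<lambda>t. t)" by (rule small_transform)
  thus "abs_fermat f = abs_fermat g" using abs_fermat_eq_iff[OF f g] by simp
qed

lemma decomp_fun_tendsto:
  assumes "\<forall>(b, \<beta>)\<in>set ts. \<beta> > 0"
  shows "(decomp_fun r ts \<longlongrightarrow> r) (at_right 0)"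
  using assms
proof (induction ts)
  case Nil
  show ?case by (simp add: decomp_fun_def[abs_def])
next
  case (Cons a ts)
  obtain b \<beta> where a: "a = (b, \<beta>)" by force
  have \<beta>: "1 / \<beta> > 0" using Cons.prems a by auto
  have "((\<lambda>t::real. t powr e) \<longlongrightarrow> 0) (at_right 0)" if "e > 0" for e
    using that by real_asymp
  from tendsto_mult_left[OF this[OF \<beta>], of b]
  have "((\<lambda>t. b * t powr (1 / \<beta>)) \<longlongrightarrow> 0) (at_right 0)" by simp
  moreover have "(decomp_fun r ts \<longlongrightarrow> r) (at_right 0)" using Cons by auto
  ultimately have "((\<lambda>t. b * t powr (1 / \<beta>) + decomp_fun r ts t) \<longlongrightarrow> 0 + r) (at_right 0)"
    by (rule tendsto_add)
  thus ?case by (simp add: decomp_fun_def[abs_def] a add_ac)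
qed

lemma is_decomposition_orders:
  assumes "is_decomposition x r ts" "(b, \<beta>) \<in> set ts"
  shows "\<beta> > 0" "\<beta> \<ge> 1" "b \<noteq> 0"
  using assms unfolding is_decomposition_def by fastforce+

lemma decomp_fun_representative:
  assumes f: "little_oh_poly f" and dec: "is_decomposition (abs_fermat f) r ts"
  shows "little_oh_poly (decomp_fun r ts)"
    and "(\<lambda>t. f t - decomp_fun r ts t) \<in> o[at_right 0](\<lambda>t. t)"
proof -
  have "\<forall>(b, \<beta>)\<in>set ts. \<beta> > 0" using is_decomposition_orders[OF dec] by auto
  thus l: "little_oh_poly (decomp_fun r ts)"
    by (intro little_oh_poly_powr_sum decomp_fun_powr_sum)
  show "(\<lambda>t. f t - decomp_fun r ts t) \<in> o[at_right 0](\<lambda>t. t)"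
    using is_decomposition_abs[OF dec] abs_fermat_eq_iff[OF f l] by simp
qed

text \<open>The decomposition function tends to its constant \<open>r\<close> and differs from
  \<open>f\<close> by o(t), so both have the same limit. This allows the standard part to be read
  off any representative.\<close>

lemma std_part_abs_fermat:
  assumes f: "little_oh_poly f" and lim: "(f \<longlongrightarrow> L) (at_right 0)"
  shows "std_part (abs_fermat f) = L"
proof -
  obtain r ts where d: "decomposition (abs_fermat f) = (r, ts)" by force
  hence dec: "is_decomposition (abs_fermat f) r ts" by (simp add: decomposition_eq_iff)
  have "\<forall>(b, \<beta>)\<in>set ts. \<beta> > 0" using is_decomposition_orders[OF dec] by auto
  hence "(decomp_fun r ts \<longlongrightarrow> r) (at_right 0)" by (rule decomp_fun_tendsto)
  from tendsto_add[OF small_id_tendsto_0[OF decomp_fun_representative(2)[OF f dec]] this]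
  have "(f \<longlongrightarrow> r) (at_right 0)" by simp
  hence "r = L" using lim tendsto_unique[OF trivial_limit_at_right_real] by blast
  with d show ?thesis by (simp add: std_part_def)
qed

lemma rep_fermat_tendsto: "(rep_fermat x \<longlongrightarrow> std_part x) (at_right 0)"
proof -
  obtain r ts where d: "decomposition x = (r, ts)" by force
  hence dec: "is_decomposition (abs_fermat (rep_fermat x)) r ts"
    by (simp add: decomposition_eq_iff abs_rep_fermat)
  have "\<forall>(b, \<beta>)\<in>set ts. \<beta> > 0" using is_decomposition_orders[OF dec] by auto
  from tendsto_add[OF small_id_tendsto_0[OF decomp_fun_representative(2)[OF rep_fermat_little_oh_poly dec]]
      decomp_fun_tendsto[OF this, of r]]
  show ?thesis using d by (simp add: std_part_def)
qed

section \<open>Powers of Fermat reals with positive standard part\<close>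

lemma fpowr_std_pos_left_inverse:
  assumes "std_part y > 0" "s \<noteq> 0"
  shows "fpowr (fpowr y s) (1 / s) = y"
proof -
  define f where "f = rep_fermat y"
  have f: "little_oh_poly f" "abs_fermat f = y"
    by (simp_all add: f_def rep_fermat_little_oh_poly abs_rep_fermat)
  have pos: "std_part (abs_fermat f) > 0" using assms f by simp
  have lim: "(f \<longlongrightarrow> std_part y) (at_right 0)" unfolding f_def by (rule rep_fermat_tendsto)
  note p = powr_std_pos_abs[OF f(1) pos, of s]
  have e: "fpowr y s = abs_fermat (\<lambda>t. f t powr s)"
    using assms p(2) f by (simp add: fpowr_def)
  \<comment> \<open>The limit of the first power is positive, so the second power again falls under
    the case of positive standard part.\<close>
  have "((\<lambda>t. f t powr s) \<longlongrightarrow> std_part y powr s) (at_right 0)"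
    using assms by (intro tendsto_intros lim) auto
  from std_part_abs_fermat[OF p(1) this] assms
  have pos': "std_part (abs_fermat (\<lambda>t. f t powr s)) > 0" by simp
  note p' = powr_std_pos_abs[OF p(1) pos', of "1 / s"]
  \<comment> \<open>Positivity of the base near 0 lets the exponents s and 1 / s multiply to
    1.\<close>
  have "eventually (\<lambda>t. f t > 0) (at_right 0)" using order_tendstoD(1)[OF lim assms(1)] .
  hence "eventually (\<lambda>t. f t = (f t powr s) powr (1 / s)) (at_right 0)"
    by eventually_elim (use assms(2) in \<open>simp add: powr_powr\<close>)
  from abs_fermat_cong(2)[OF f(1) this]
  have "y = powr_std_pos (fpowr y s) (1 / s)" unfolding e p'(2) f(2) .
  moreover have "std_part (fpowr y s) > 0" using pos' by (simp add: e)
  ultimately show "fpowr (fpowr y s) (1 / s) = y" unfolding fpowr_def[of "fpowr y s"] by metis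
qed

section \<open>Leading terms of positive infinitesimals and their powers\<close>

lemma harm_diff_ereal:
  assumes "0 < a" "a < b"
  shows "ereal a \<ominus> ereal b = ereal (1 / (1 / a - 1 / b))"
proof -
  have "1 / a - 1 / b > 0" using assms by (simp add: field_simps)
  thus ?thesis using assms by (simp add: harm_diff_def inverse_eq_divide)
qed

text \<open>These are the infinitesimal terms left after division by the leading monomial b
  t^(1/\<beta>), that is, the terms inside the bracket of \<open>powr_inf\<close>. The order is
  \<gamma> \<ominus> \<beta> computed in the reals; \<open>harm_diff_ereal\<close> justifies this
  for 0 < \<gamma> < \<beta>.\<close>

definition quotient_terms :: "real \<Rightarrow> real \<Rightarrow> (real \<times> real) list \<Rightarrow> (real \<times> real) list" where
  "quotient_terms b \<beta> ts = map (\<lambda>(c, \<gamma>). (c / b, 1 / (1 / \<gamma> - 1 / \<beta>))) ts"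

lemma quotient_terms_pos:
  assumes "\<forall>(c, \<gamma>)\<in>set ts. 0 < \<gamma> \<and> \<gamma> < \<beta>"
  shows "\<forall>(c, \<gamma>)\<in>set (quotient_terms b \<beta> ts). \<gamma> > 0"
proof -
  have "1 / (1 / \<gamma> - 1 / \<beta>) > 0" if "0 < \<gamma>" "\<gamma> < \<beta>" for \<gamma>
    using that by (simp add: field_simps)
  thus ?thesis using assms by (force simp: quotient_terms_def)
qed

lemma decomp_fun_factor:
  assumes "b \<noteq> 0" "t > 0"
  shows "decomp_fun 0 ((b, \<beta>) # ts) t = b * t powr (1 / \<beta>) * decomp_fun 1 (quotient_terms b \<beta> ts) t"
proof -
  have "(\<Sum>(c, \<gamma>)\<leftarrow>ts. c * t powr (1 / \<gamma>))
      = b * t powr (1 / \<beta>) * (\<Sum>(c, \<gamma>)\<leftarrow>quotient_terms b \<beta> ts. c * t powr (1 / \<gamma>))"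
    unfolding quotient_terms_def
    by (induction ts) (use assms in \<open>auto simp: algebra_simps powr_diff\<close>)
  thus ?thesis by (simp add: decomp_fun_def algebra_simps)
qed

lemma pos_infinitesimal_decomposition:
  assumes "pos_infinitesimal x"
  obtains b \<beta> ts where "decomposition x = (0, (b, \<beta>) # ts)" "b > 0" "\<beta> \<ge> 1"
    "\<forall>(c, \<gamma>)\<in>set ts. 0 < \<gamma> \<and> \<gamma> < \<beta>"
proof -
  obtain r us where d: "decomposition x = (r, us)" by force
  hence dec: "is_decomposition x r us" by (simp add: decomposition_eq_iff)
  have r: "r = 0" using assms d by (simp add: pos_infinitesimal_def D_infty_def std_part_def)
  have "us \<noteq> []"
    using assms dec r by (auto simp: pos_infinitesimal_def is_decomposition_def)
  then obtain b \<beta> ts where us: "us = (b, \<beta>) # ts" by (cases us) auto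
  have "b > 0" using assms d us by (simp add: pos_infinitesimal_def term_coeff_def)
  moreover have "\<beta> \<ge> 1" using is_decomposition_orders[OF dec, of b \<beta>] us by simp
  moreover have "\<forall>(c, \<gamma>)\<in>set ts. \<gamma> < \<beta>"
    using dec us unfolding is_decomposition_def by auto
  moreover have "\<forall>(c, \<gamma>)\<in>set ts. 0 < \<gamma>"
    using is_decomposition_orders[OF dec] us by auto
  ultimately show ?thesis using that d r us by blast
qed

lemma leading_term_tendsto:
  assumes "b \<noteq> 0" "\<forall>(c, \<gamma>)\<in>set ts. 0 < \<gamma> \<and> \<gamma> < \<beta>"
  shows "((\<lambda>t. decomp_fun 0 ((b, \<beta>) # ts) t / t powr (1 / \<beta>)) \<longlongrightarrow> b) (at_right 0)"
proof -
  have "((\<lambda>t. b * decomp_fun 1 (quotient_terms b \<beta> ts) t) \<longlongrightarrow> b * 1) (at_right 0)"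
    by (intro tendsto_intros decomp_fun_tendsto quotient_terms_pos assms)
  moreover have "eventually (\<lambda>t. b * decomp_fun 1 (quotient_terms b \<beta> ts) t
      = decomp_fun 0 ((b, \<beta>) # ts) t / t powr (1 / \<beta>)) (at_right 0)"
    using eventually_at_right_less[of "0::real"]
    by eventually_elim (simp add: decomp_fun_factor assms)
  ultimately show ?thesis using Lim_transform_eventually by fastforce
qed

lemma eventually_decomp_fun_pos:
  assumes "b > 0" "\<forall>(c, \<gamma>)\<in>set ts. 0 < \<gamma> \<and> \<gamma> < \<beta>"
  shows "eventually (\<lambda>t. decomp_fun 0 ((b, \<beta>) # ts) t > 0) (at_right 0)"
proof -
  have "eventually (\<lambda>t. decomp_fun 0 ((b, \<beta>) # ts) t / t powr (1 / \<beta>) > 0) (at_right 0)"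
    by (rule order_tendstoD(1)[OF leading_term_tendsto]) (use assms in auto)
  thus ?thesis using eventually_at_right_less[of "0::real"]
    by eventually_elim (simp add: zero_less_divide_iff)
qed

text \<open>The three classes multiplied in \<open>powr_inf\<close> have representatives whose
  product is, by \<open>decomp_fun_factor\<close>, exactly the power of the decomposition function
  for small t > 0.\<close>

lemma powr_inf_abs:
  assumes d: "decomposition x = (0, (b, \<beta>) # ts)" and b: "b > 0" and \<beta>: "\<beta> \<ge> 1"
    and ts: "\<forall>(c, \<gamma>)\<in>set ts. 0 < \<gamma> \<and> \<gamma> < \<beta>" and q: "q > 0"
  shows "little_oh_poly (\<lambda>t. decomp_fun 0 ((b, \<beta>) # ts) t powr q)"
    and "powr_inf x q = abs_fermat (\<lambda>t. decomp_fun 0 ((b, \<beta>) # ts) t powr q)"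
proof -
  define us where "us = quotient_terms b \<beta> ts"
  have us: "\<forall>(c, \<gamma>)\<in>set us. \<gamma> > 0" unfolding us_def by (rule quotient_terms_pos[OF ts])
  have lus: "little_oh_poly (decomp_fun 1 us)"
    by (intro little_oh_poly_powr_sum decomp_fun_powr_sum us)
  have lim: "(decomp_fun 1 us \<longlongrightarrow> 1) (at_right 0)" by (rule decomp_fun_tendsto[OF us])
  have "std_part (abs_fermat (decomp_fun 1 us)) > 0"
    using std_part_abs_fermat[OF lus lim] by simp
  note P = powr_std_pos_abs[OF lus this, of q]
  have "(\<Sum>j=2..num_terms x. of_real (term_coeff x j / term_coeff x 1) *
           dt (real_of_ereal (ereal (term_order x j) \<ominus> ereal (term_order x 1))))
      = (\<Sum>i<length ts. of_real (fst (ts ! i) / b) * dt (1 / (1 / snd (ts ! i) - 1 / \<beta>)))"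
  \<comment> \<open>Terms are numbered from 1 and the leading one is split off, so term j is entry j
    - 2 of \<open>ts\<close>. Goal 5 is the equality of the summands.\<close>
  proof (rule sum.reindex_bij_witness[of _ "\<lambda>i. i + 2" "\<lambda>j. j - 2"], goal_cases)
    case (5 j)
    hence j: "j = Suc (Suc (j - 2))" "j - 2 < length ts" using d by (auto simp: num_terms_def)
    define i where "i = j - 2"
    have "j = Suc (Suc i)" using j by (simp add: i_def)
    moreover have "ts ! i \<in> set ts" using j by (simp add: i_def)
    hence "0 < snd (ts ! i)" "snd (ts ! i) < \<beta>" using ts by auto
    ultimately show ?case using d
      by (simp add: term_coeff_def term_order_def harm_diff_ereal i_def[symmetric])
  qed (use d in \<open>auto simp: num_terms_def\<close>)
  also have "\<dots> = (\<Sum>(c, \<gamma>)\<leftarrow>us. of_real c * dt \<gamma>)"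
    by (simp add: us_def quotient_terms_def sum_list_sum_nth atLeast0LessThan case_prod_beta)
  finally have "1 + (\<Sum>j=2..num_terms x. of_real (term_coeff x j / term_coeff x 1) *
           dt (real_of_ereal (ereal (term_order x j) \<ominus> ereal (term_order x 1))))
      = abs_fermat (decomp_fun 1 us)"
    using decomp_fun_abs[OF us, of 1] by simp
  hence "powr_inf x q
      = abs_fermat (\<lambda>_. b powr q) * abs_fermat (\<lambda>t. t powr (q / \<beta>)) * abs_fermat (\<lambda>t. decomp_fun 1 us t powr q)"
    using d P(2) by (simp add: powr_inf_def term_coeff_def term_order_def of_real_fermat dt_def)
  also have "\<dots> = abs_fermat (\<lambda>t. b powr q * t powr (q / \<beta>) * decomp_fun 1 us t powr q)"
    using q \<beta> P(1)
    by (simp add: abs_fermat_mult little_oh_poly_const little_oh_poly_powr little_oh_poly_mult)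
  finally have 1: "powr_inf x q = \<dots>" .
  have 2: "little_oh_poly (\<lambda>t. b powr q * t powr (q / \<beta>) * decomp_fun 1 us t powr q)"
    using q \<beta> P(1) by (intro little_oh_poly_const little_oh_poly_powr little_oh_poly_mult) auto
  have 3: "eventually (\<lambda>t. b powr q * t powr (q / \<beta>) * decomp_fun 1 us t powr q
      = decomp_fun 0 ((b, \<beta>) # ts) t powr q) (at_right 0)"
    using eventually_at_right_less[of "0::real"] order_tendstoD(1)[OF lim zero_less_one]
  proof eventually_elim
    case (elim t)
    have "decomp_fun 0 ((b, \<beta>) # ts) t = b * t powr (1 / \<beta>) * decomp_fun 1 us t"
      using elim b unfolding us_def by (intro decomp_fun_factor) auto
    thus ?case using elim b by (simp add: powr_mult powr_powr)
  qed
  from abs_fermat_cong[OF 2 3] 1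
  show "little_oh_poly (\<lambda>t. decomp_fun 0 ((b, \<beta>) # ts) t powr q)"
    and "powr_inf x q = abs_fermat (\<lambda>t. decomp_fun 0 ((b, \<beta>) # ts) t powr q)" by simp_all
qed

text \<open>Passing to the decomposition function costs an error o(t), which is o(t^e) because e
  \<le> 1, so the behaviour c t^e at 0 survives. Its positivity near 0 excludes an empty
  decomposition and a negative leading coefficient. For e > 1 the class would be 0.\<close>

lemma pos_infinitesimal_abs_fermat:
  assumes f: "little_oh_poly f" and e: "0 < e" "e \<le> 1" and c: "c > 0"
    and lim: "((\<lambda>t. f t / t powr e) \<longlongrightarrow> c) (at_right 0)"
  shows "pos_infinitesimal (abs_fermat f)"
proof -
  obtain r ts where d: "decomposition (abs_fermat f) = (r, ts)" by force
  hence dec: "is_decomposition (abs_fermat f) r ts" by (simp add: decomposition_eq_iff)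
  note rep = decomp_fun_representative[OF f dec]
  have "((\<lambda>t::real. t powr e) \<longlongrightarrow> 0) (at_right 0)" using e(1) by real_asymp
  from tendsto_mult[OF lim this] have "((\<lambda>t. f t / t powr e * t powr e) \<longlongrightarrow> 0) (at_right 0)"
    by simp
  moreover have "eventually (\<lambda>t. f t / t powr e * t powr e = f t) (at_right 0)"
    using eventually_at_right_less[of "0::real"] by eventually_elim simp
  ultimately have "(f \<longlongrightarrow> 0) (at_right 0)" by (rule Lim_transform_eventually)
  from std_part_abs_fermat[OF f this] have std: "std_part (abs_fermat f) = 0" .
  hence r: "r = 0" using d by (simp add: std_part_def)
  have "(\<lambda>t::real. t) \<in> O[at_right 0](\<lambda>t. t powr e)"
  proof (rule bigoI[of _ 1])
    show "\<forall>\<^sub>F t::real in at_right 0. norm t \<le> 1 * norm (t powr e)"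
      using eventually_at_right_real[of 0 "1::real", OF zero_less_one]
    proof eventually_elim
      case (elim t)
      have "t powr 1 \<le> t powr e" using elim e by (intro powr_mono') auto
      with elim show ?case by simp
    qed
  qed
  with rep(2) have "(\<lambda>t. f t - decomp_fun r ts t) \<in> o[at_right 0](\<lambda>t. t powr e)"
    by (rule landau_o.small_big_trans)
  hence "((\<lambda>t. (f t - decomp_fun r ts t) / t powr e) \<longlongrightarrow> 0) (at_right 0)"
    by (rule smalloD_tendsto)
  from tendsto_diff[OF lim this]
  have lim': "((\<lambda>t. decomp_fun r ts t / t powr e) \<longlongrightarrow> c) (at_right 0)"
    by (simp add: diff_divide_distrib)
  from order_tendstoD(1)[OF this c]
  have "eventually (\<lambda>t. decomp_fun r ts t / t powr e > 0) (at_right 0)" .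
  hence evpos: "eventually (\<lambda>t. decomp_fun r ts t > 0 \<and> t > 0) (at_right 0)"
    using eventually_at_right_less[of "0::real"]
    by eventually_elim (simp add: zero_less_divide_iff)
  have "ts \<noteq> []"
  proof
    assume "ts = []"
    hence "eventually (\<lambda>t::real. False) (at_right 0)"
      using evpos by (simp add: decomp_fun_def r)
    thus False by simp
  qed
  then obtain b \<beta> us where ts: "ts = (b, \<beta>) # us" by (cases ts) auto
  have b: "b \<noteq> 0" using is_decomposition_orders[OF dec, of b \<beta>] ts by simp
  have "\<forall>(c, \<gamma>)\<in>set us. \<gamma> < \<beta>" using dec ts unfolding is_decomposition_def by auto
  moreover have "\<forall>(c, \<gamma>)\<in>set us. 0 < \<gamma>" using is_decomposition_orders[OF dec] ts by auto
  ultimately have "\<forall>(c, \<gamma>)\<in>set us. 0 < \<gamma> \<and> \<gamma> < \<beta>" by auto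
  from leading_term_tendsto[OF b this]
  have "((\<lambda>t. decomp_fun r ts t / t powr (1 / \<beta>)) \<longlongrightarrow> b) (at_right 0)" by (simp add: r ts)
  moreover have "eventually (\<lambda>t. decomp_fun r ts t / t powr (1 / \<beta>) \<ge> 0) (at_right 0)"
    using evpos by eventually_elim simp
  ultimately have "b \<ge> 0" by (rule tendsto_lowerbound) simp
  with b have "b > 0" by simp
  moreover have "abs_fermat f \<noteq> 0"
  proof
    assume "abs_fermat f = 0"
    hence "is_decomposition (abs_fermat f) 0 []" by (simp add: is_decomposition_def)
    from is_decomposition_unique[OF this dec] ts show False by simp
  qed
  ultimately show ?thesis using std d ts
    by (simp add: pos_infinitesimal_def D_infty_def term_coeff_def)
qed

section \<open>Truncation and iterated powers\<close>

lemma powr_lipschitz_unit_interval: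
  fixes u v q :: real
  assumes "q \<ge> 1" "u \<in> {0<..1}" "v \<in> {0<..1}"
  shows "\<bar>u powr q - v powr q\<bar> \<le> q * \<bar>u - v\<bar>"
proof -
  have "norm (u powr q - v powr q) \<le> q * norm (u - v)"
  proof (rule field_differentiable_bound[of "{0<..1}" "\<lambda>u. u powr q" "\<lambda>u. q * u powr (q - 1)"])
    fix z :: real assume z: "z \<in> {0<..1}"
    thus "((\<lambda>u. u powr q) has_field_derivative q * z powr (q - 1)) (at z within {0<..1})"
      by (auto intro!: derivative_eq_intros)
    \<comment> \<open>Here q \<ge> 1 enters: for 0 < q < 1 the derivative is unbounded near
      0.\<close>
    have "z powr (q - 1) \<le> 1" using z assms(1) by (intro powr_le1) auto
    thus "norm (q * z powr (q - 1)) \<le> q" using assms(1) by (simp add: abs_mult)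
  qed (use assms in auto)
  thus ?thesis by simp
qed

text \<open>With all exponents at most 1 there is nothing for o(t) to absorb: the difference to the
  decomposition function is a power sum with exponents in [0, 1] that is o(t), so all its
  coefficients vanish.\<close>

lemma powr_sum_truncation_eq:
  assumes A: "finite A" "A \<subseteq> {0..1}" and f: "eventually (\<lambda>t. f t = powr_sum A c t) (at_right 0)"
    and lf: "little_oh_poly f" and dec: "is_decomposition (abs_fermat f) r ts"
  shows "eventually (\<lambda>t. f t = decomp_fun r ts t) (at_right 0)"
proof -
  define B where "B = A \<union> decomp_exps ts"
  \<comment> \<open>\<open>c\<close> is arbitrary outside \<open>A\<close>, hence the mask;
    \<open>decomp_coeff\<close> is 0 outside its own exponents.\<close>
  define d where "d = (\<lambda>\<alpha>. (if \<alpha> \<in> A then c \<alpha> else 0) - decomp_coeff r ts \<alpha>)"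
  have orders: "\<forall>(b, \<beta>)\<in>set ts. \<beta> \<ge> 1" using is_decomposition_orders[OF dec] by auto
  hence B: "finite B" "B \<subseteq> {0..1}" using A by (auto simp: B_def decomp_exps_def)
  have eq: "powr_sum A c t - decomp_fun r ts t = powr_sum B d t" if "t > 0" for t
    using B(1) that powr_sum_mono[of B A c t] decomp_fun_eq_powr_sum[OF orders, of B t r]
    by (simp add: B_def d_def powr_sum_def left_diff_distrib sum_subtractf)
  have "eventually (\<lambda>t. f t - decomp_fun r ts t = powr_sum B d t) (at_right 0)"
    using f eventually_at_right_less[of "0::real"] by eventually_elim (simp add: eq)
  from small_transform[OF decomp_fun_representative(2)[OF lf dec] this]
  have "powr_sum B d \<in> o[at_right 0](\<lambda>t. t)" .
  from powr_sum_small_imp_zero[OF B this] have "powr_sum B d t = 0" for t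
    by (simp add: powr_sum_def)
  with eq have "powr_sum A c t = decomp_fun r ts t" if "t > 0" for t using that by fastforce
  thus ?thesis
    using f eventually_at_right_less[of "0::real"] by (auto elim: eventually_elim2)
qed

text \<open>The power is evaluated on the decomposition function \<open>h\<close>, not on
  \<open>f\<close>, so the o(t) difference between them must stay o(t) after taking powers. For q
  \<ge> 1 the Lipschitz bound gives this; otherwise \<open>h\<close> and \<open>f\<close> agree near
  0. In the application \<open>g\<close> is the original decomposition function, already known to be
  a little-oh polynomial.\<close>

lemma fpowr_abs_fermat:
  assumes f: "little_oh_poly f" and pos: "pos_infinitesimal (abs_fermat f)" and q: "q > 0"
    and evpos: "eventually (\<lambda>t. f t > 0) (at_right 0)"
    and g: "little_oh_poly g" "eventually (\<lambda>t. f t powr q = g t) (at_right 0)"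
    and cond: "q \<ge> 1 \<or> (\<exists>A c. finite A \<and> A \<subseteq> {0..1} \<and> eventually (\<lambda>t. f t = powr_sum A c t) (at_right 0))"
  shows "fpowr (abs_fermat f) q = abs_fermat g"
proof -
  obtain b \<beta> ts where d: "decomposition (abs_fermat f) = (0, (b, \<beta>) # ts)"
    and b: "b > 0" and \<beta>: "\<beta> \<ge> 1" and ts: "\<forall>(c, \<gamma>)\<in>set ts. 0 < \<gamma> \<and> \<gamma> < \<beta>"
    using pos_infinitesimal_decomposition[OF pos] .
  define h where "h = decomp_fun 0 ((b, \<beta>) # ts)"
  have dec: "is_decomposition (abs_fermat f) 0 ((b, \<beta>) # ts)" using d decomposition_eq_iff by simp
  note P = powr_inf_abs[OF d b \<beta> ts q]
  have e: "fpowr (abs_fermat f) q = abs_fermat (\<lambda>t. h t powr q)"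
    using pos P(2) by (simp add: fpowr_def pos_infinitesimal_def D_infty_def h_def)
  have small: "(\<lambda>t. h t powr q - f t powr q) \<in> o[at_right 0](\<lambda>t. t)"
  proof (cases "q \<ge> 1")
    case True
    have diff: "(\<lambda>t. f t - h t) \<in> o[at_right 0](\<lambda>t. t)"
      unfolding h_def by (rule decomp_fun_representative(2)[OF f dec])
    have hlim: "(h \<longlongrightarrow> 0) (at_right 0)"
      unfolding h_def using ts \<beta> by (intro decomp_fun_tendsto) auto
    from tendsto_add[OF small_id_tendsto_0[OF diff] hlim]
    have flim: "(f \<longlongrightarrow> 0) (at_right 0)" by simp
    have hpos: "eventually (\<lambda>t. h t > 0) (at_right 0)"
      unfolding h_def by (rule eventually_decomp_fun_pos[OF b ts])
    have "\<forall>\<^sub>F t in at_right 0. norm (h t powr q - f t powr q) \<le> q * norm (f t - h t)"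
      using order_tendstoD(2)[OF hlim zero_less_one] order_tendstoD(2)[OF flim zero_less_one] hpos evpos
      by eventually_elim
        (use powr_lipschitz_unit_interval[OF True] in \<open>simp add: abs_minus_commute\<close>)
    hence "(\<lambda>t. h t powr q - f t powr q) \<in> O[at_right 0](\<lambda>t. f t - h t)" by (rule bigoI)
    thus ?thesis using diff by (rule landau_o.big_small_trans)
  next
    case False
    with cond obtain A c where "finite A" "A \<subseteq> {0..1}"
      "eventually (\<lambda>t. f t = powr_sum A c t) (at_right 0)" by blast
    from powr_sum_truncation_eq[OF this f dec]
    have "eventually (\<lambda>t. 0 = h t powr q - f t powr q) (at_right 0)"
      by eventually_elim (simp add: h_def)
    from small_transform[OF _ this] show ?thesis by simp
  qed
  have "eventually (\<lambda>t. h t powr q - f t powr q = h t powr q - g t) (at_right 0)"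
    using g(2) by eventually_elim simp
  from small_transform[OF small this] show ?thesis
    unfolding e using abs_fermat_eq_iff[of "\<lambda>t. h t powr q" g] P(1) g(1) by (simp add: h_def)
qed

text \<open>The first power behaves like b^q t^(q/\<beta>). The bound q \<le> \<beta> keeps this
  exponent at most 1, so the class is again a positive infinitesimal, and the second power can be
  computed by \<open>fpowr_abs_fermat\<close>.\<close>

lemma fpowr_left_inverse:
  assumes pos: "pos_infinitesimal x" and d: "decomposition x = (0, (b, \<beta>) # ts)"
    and q: "q > 0" "q \<le> \<beta>"
    and cond: "q \<le> 1 \<or> (\<exists>A c. finite A \<and> A \<subseteq> {0..1} \<and>
      eventually (\<lambda>t. decomp_fun 0 ((b, \<beta>) # ts) t powr q = powr_sum A c t) (at_right 0))"
  shows "fpowr (fpowr x q) (1 / q) = x"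
proof -
  have *: "b > 0" "\<beta> \<ge> 1" "\<forall>(c, \<gamma>)\<in>set ts. 0 < \<gamma> \<and> \<gamma> < \<beta>"
    using pos_infinitesimal_decomposition[OF pos] d by auto
  define h where "h = decomp_fun 0 ((b, \<beta>) # ts)"
  define f where "f = (\<lambda>t. h t powr q)"
  have hpos: "eventually (\<lambda>t. h t > 0) (at_right 0)"
    unfolding h_def by (rule eventually_decomp_fun_pos[OF *(1,3)])
  note P = powr_inf_abs[OF d * q(1), folded h_def, folded f_def]
  have e: "fpowr x q = abs_fermat f"
    using pos P(2) by (simp add: fpowr_def pos_infinitesimal_def D_infty_def)
  have "((\<lambda>t. h t / t powr (1 / \<beta>)) \<longlongrightarrow> b) (at_right 0)"
    unfolding h_def by (rule leading_term_tendsto) (use * in auto)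
  hence "((\<lambda>t. (h t / t powr (1 / \<beta>)) powr q) \<longlongrightarrow> b powr q) (at_right 0)"
    using *(1) by (intro tendsto_intros) auto
  moreover have "eventually (\<lambda>t. (h t / t powr (1 / \<beta>)) powr q = f t / t powr (q / \<beta>)) (at_right 0)"
    using hpos by eventually_elim (simp add: f_def powr_divide powr_powr)
  ultimately have lim: "((\<lambda>t. f t / t powr (q / \<beta>)) \<longlongrightarrow> b powr q) (at_right 0)"
    by (rule Lim_transform_eventually)
  have pos': "pos_infinitesimal (abs_fermat f)"
    by (rule pos_infinitesimal_abs_fermat[OF P(1) _ _ _ lim]) (use q * in auto)
  have dec: "is_decomposition x 0 ((b, \<beta>) # ts)" using d decomposition_eq_iff by simp
  have x: "x = abs_fermat h" unfolding h_def by (rule is_decomposition_abs[OF dec])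
  have lh: "little_oh_poly h"
    using *(2,3) unfolding h_def by (intro little_oh_poly_powr_sum decomp_fun_powr_sum) auto
  have "eventually (\<lambda>t. f t > 0) (at_right 0)"
    using hpos by eventually_elim (simp add: f_def)
  moreover have "eventually (\<lambda>t. f t powr (1 / q) = h t) (at_right 0)"
    using hpos by eventually_elim (use q in \<open>simp add: f_def powr_powr\<close>)
  \<comment> \<open>The alternative q \<le> 1 puts the second exponent 1 / q into the Lipschitz
    case.\<close>
  moreover have "1 / q \<ge> 1 \<or> (\<exists>A c. finite A \<and> A \<subseteq> {0..1} \<and> eventually (\<lambda>t. f t = powr_sum A c t) (at_right 0))"
    using cond q by (auto simp: f_def h_def)
  ultimately have "fpowr (abs_fermat f) (1 / q) = abs_fermat h"
    using q by (intro fpowr_abs_fermat[OF P(1) pos' _ _ lh]) auto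
  thus "fpowr (fpowr x q) (1 / q) = x" unfolding e x[symmetric] .
qed

section \<open>Exponents of powers and completeness\<close>

lemma powr_sum_mult:
  assumes "finite A" "finite B" "t > 0"
  shows "powr_sum A c t * powr_sum B d t
    = powr_sum ((\<lambda>z. fst z + snd z) ` (A \<times> B))
        (\<lambda>\<delta>. \<Sum>z\<in>{z \<in> A \<times> B. fst z + snd z = \<delta>}. c (fst z) * d (snd z)) t"
proof -
  have "powr_sum A c t * powr_sum B d t
      = (\<Sum>z\<in>A \<times> B. c (fst z) * d (snd z) * t powr (fst z + snd z))"
    by (simp add: powr_sum_def sum_product sum.cartesian_product case_prod_beta powr_add mult_ac)
  \<comment> \<open>Pairs of exponents with equal sum are collected, as \<open>powr_sum\<close>
    needs a set of distinct exponents.\<close>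
  also have "\<dots> = (\<Sum>\<delta>\<in>(\<lambda>z. fst z + snd z) ` (A \<times> B). \<Sum>z\<in>{z \<in> A \<times> B. fst z + snd z = \<delta>}.
      c (fst z) * d (snd z) * t powr (fst z + snd z))"
    using assms by (intro sum.image_gen) auto
  also have "\<dots> = powr_sum ((\<lambda>z. fst z + snd z) ` (A \<times> B))
        (\<lambda>\<delta>. \<Sum>z\<in>{z \<in> A \<times> B. fst z + snd z = \<delta>}. c (fst z) * d (snd z)) t"
    unfolding powr_sum_def sum_distrib_right by (intro sum.cong) auto
  finally show ?thesis .
qed

text \<open>Exponents add under multiplication, so each further factor raises the upper bound by m.
  The explicit bound is what later places the exponents in [0, 1].\<close>

lemma powr_sum_power:
  assumes "finite A" "A \<subseteq> {0..m}"
  shows "\<exists>B d. finite B \<and> B \<subseteq> {0..real n * m} \<and> (\<forall>t>0. powr_sum A c t ^ n = powr_sum B d t)"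
proof (induction n)
  case 0
  show ?case by (rule exI[of _ "{0}"], rule exI[of _ "\<lambda>_. 1"]) (simp add: powr_sum_def)
next
  case (Suc n)
  then obtain B d where B: "finite B" "B \<subseteq> {0..real n * m}"
    "\<And>t. t > 0 \<Longrightarrow> powr_sum A c t ^ n = powr_sum B d t" by blast
  have "(\<lambda>z. fst z + snd z) ` (A \<times> B) \<subseteq> {0..real (Suc n) * m}"
    using assms(2) B(2) by (force simp: algebra_simps intro: add_nonneg_nonneg add_mono)
  thus ?case
    using powr_sum_mult[OF assms(1) B(1), of _ c d] B(3) assms(1) B(1)
    by (intro exI[of _ "(\<lambda>z. fst z + snd z) ` (A \<times> B)"] exI conjI allI impI) auto
qed

text \<open>The reciprocal of \<open>omega\<close> is the exponent of the monomial indexed by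
  \<gamma> in the expansion of the bracket of \<open>powr_inf\<close>. Adding s / \<beta>_1 gives
  its exponent in the power of x, so a value below 1 in \<open>loses_information\<close> means that
  this monomial is o(t).\<close>

lemma omega_eq:
  assumes "\<And>j. j \<in> {2..num_terms x} \<Longrightarrow> 0 < term_order x j \<and> term_order x j < term_order x 1"
  shows "omega x \<gamma> = inverse (ereal
    (\<Sum>j=2..num_terms x. real (\<gamma> (j - 1)) * (1 / term_order x j - 1 / term_order x 1)))"
proof -
  have "inverse ((ereal (term_order x j) \<ominus> ereal (term_order x 1)) / ereal (real (\<gamma> (j - 1))))
      = ereal (real (\<gamma> (j - 1)) * (1 / term_order x j - 1 / term_order x 1))"
    if "j \<in> {2..num_terms x}" for j
  proof -
    define D where "D = 1 / term_order x j - 1 / term_order x 1"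
    have "D > 0" using assms[OF that] by (auto simp: D_def intro!: divide_strict_left_mono)
    moreover have "ereal (term_order x j) \<ominus> ereal (term_order x 1) = ereal (1 / D)"
      using assms[OF that] by (simp add: harm_diff_ereal D_def)
    ultimately show ?thesis unfolding D_def[symmetric]
      \<comment> \<open>A zero entry divides by 0 and yields \<infinity>, whose inverse contributes
        0.\<close>
      by (cases "\<gamma> (j - 1) = 0") (simp_all add: divide_ereal_def inverse_eq_divide)
  qed
  thus ?thesis by (simp add: omega_def harm_sum_def)
qed

text \<open>Only multi-indices concentrated on a single term are tested: the n-th power of that term
  in the bracket, times the leading factor, has the exponent on the left of
  \<open>gt\<close>.\<close>

lemma loses_informationI:
  assumes orders: "\<And>j. j \<in> {2..num_terms x} \<Longrightarrow> 0 < term_order x j \<and> term_order x j < term_order x 1"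
    and r: "r \<in> {2..num_terms x}" and n: "n \<ge> 1" "real n \<le> k_bound x s" and s: "s > 0"
    and gt: "real n * (1 / term_order x r - 1 / term_order x 1) + s / term_order x 1 > 1"
  shows "loses_information x s r"
proof -
  \<comment> \<open>Entry i of a multi-index belongs to term i + 1, hence the position r -
    1.\<close>
  define \<gamma> where "\<gamma> = (\<lambda>i. if i = r - 1 then n else 0)"
  define D where "D = 1 / term_order x r - 1 / term_order x 1"
  have D: "D > 0" using orders[OF r] by (auto simp: D_def intro!: divide_strict_left_mono)
  have pos: "term_order x 1 > 0" using orders[OF r] by simp
  have "(\<Sum>j=2..num_terms x. real (\<gamma> (j - 1)) * (1 / term_order x j - 1 / term_order x 1))
      = (\<Sum>j=2..num_terms x. if j = r then real n * D else 0)"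
    by (intro sum.cong) (use r in \<open>auto simp: \<gamma>_def D_def\<close>)
  also have "\<dots> = real n * D" using r by simp
  finally have "omega x \<gamma> = ereal (1 / (real n * D))"
    using omega_eq[OF orders, of \<gamma>] D n(1) by (simp add: inverse_eq_divide)
  moreover have "ereal (1 / (real n * D)) \<oplus> ereal (term_order x 1 / s)
      = ereal (1 / (real n * D + s / term_order x 1))"
  proof -
    have "real n * D > 0" using D n(1) by simp
    moreover have "s / term_order x 1 > 0" using s pos by simp
    ultimately have "real n * D + s / term_order x 1 > 0" by (rule add_pos_pos)
    thus ?thesis using D n(1) s pos by (simp add: harm_add_def inverse_eq_divide)
  qed
  moreover have "1 / (real n * D + s / term_order x 1) < 1" using gt by (simp add: D_def)
  moreover have "(\<Sum>i=1..num_terms x - 1. \<gamma> i) = n"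
    using r by (auto simp: \<gamma>_def)
  moreover have "\<gamma> (r - 1) \<noteq> 0" using n by (simp add: \<gamma>_def)
  ultimately have "\<exists>(n::nat) (\<gamma>::nat \<Rightarrow> nat). 1 \<le> n \<and> real n \<le> k_bound x s \<and>
      (\<Sum>i=1..num_terms x - 1. \<gamma> i) = n \<and> \<gamma> (r - 1) \<noteq> 0 \<and>
      omega x \<gamma> \<oplus> ereal (term_order x 1 / s) < 1"
    using n by (intro exI[of _ n] exI[of _ \<gamma>]) simp
  thus ?thesis using r by (simp add: loses_information_def)
qed

lemma complete_imp_natural_exponent:
  assumes orders: "\<And>j. j \<in> {2..num_terms x} \<Longrightarrow> 0 < term_order x j \<and> term_order x j < term_order x 1"
    and N: "num_terms x \<ge> 2" and s: "s > 0" and complete: "all_terms_complete x s"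
  shows "\<exists>n\<ge>1. s = real n \<and> (\<forall>j\<in>{1..num_terms x}. real n \<le> term_order x j)"
proof -
  define D where "D = 1 / term_order x 2 - 1 / term_order x 1"
  have two: "2 \<in> {2..num_terms x}" using N by simp
  have D: "D > 0" using orders[OF two] by (auto simp: D_def intro!: divide_strict_left_mono)
  define m where "m = \<lceil>1 / D\<rceil>"
  have m: "m \<ge> 1" using D by (simp add: m_def)
  have k: "k_bound x s = (if s \<in> \<nat> then min (of_int m) s else of_int m)"
    using orders[OF two] by (simp add: k_bound_def harm_diff_ereal m_def D_def)
  \<comment> \<open>The choice of m gives m D \<ge> 1, and s / \<beta>_1 > 0 pushes the exponent
    strictly above 1. A bound reaching m would therefore lose the second term.\<close>
  have "k_bound x s \<noteq> of_int m"
  proof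
    assume "k_bound x s = of_int m"
    moreover have "1 / D \<le> of_int m" by (simp add: m_def)
    hence "1 \<le> of_int m * D" using D by (simp add: field_simps)
    moreover have "s / term_order x 1 > 0" using s orders[OF two] by simp
    ultimately have "loses_information x s 2"
      using m s by (intro loses_informationI[OF orders two, of "nat m"]) (auto simp: D_def)
    thus False using complete N by (auto simp: all_terms_complete_def)
  qed
  \<comment> \<open>The bound can differ from m only through the cut-off at s, which exists only for
    natural s.\<close>
  hence "s \<in> \<nat>" "k_bound x s = s" using k by (auto simp: min_def split: if_splits)
  then obtain n where n: "s = real n" by (auto simp: Nats_def)
  have "n \<ge> 1" using n s by simp
  moreover have "real n \<le> term_order x j" if "j \<in> {1..num_terms x}" for j
  proof (cases "j = 1")
    case True
    have "\<not> loses_information x s 1" using complete N by (auto simp: all_terms_complete_def)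
    with True n show ?thesis by (simp add: loses_information_def)
  next
    case False
    hence j: "j \<in> {2..num_terms x}" using that by auto
    have "\<not> loses_information x s j" using complete that by (auto simp: all_terms_complete_def)
    hence "\<not> real n * (1 / term_order x j - 1 / term_order x 1) + s / term_order x 1 > 1"
      using loses_informationI[OF orders j \<open>n \<ge> 1\<close> _ s] \<open>k_bound x s = s\<close> n by auto
    \<comment> \<open>As s = n, the two contributions of the leading order cancel.\<close>
    hence "real n / term_order x j \<le> 1" using n by (simp add: algebra_simps)
    thus ?thesis using orders[OF j] by (simp add: field_simps)
  qed
  ultimately show ?thesis using n by blast
qed

text \<open>A single term gives the single exponent s / \<beta>. With more terms s is a natural
  number n and every order is at least n, so the exponents are at most 1 / n and those of the n-th
  power at most 1.\<close>

lemma complete_imp_powr_sum: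
  assumes d: "decomposition x = (0, (b, \<beta>) # ts)" and b: "b > 0" and \<beta>: "\<beta> \<ge> 1"
    and ts: "\<forall>(c, \<gamma>)\<in>set ts. 0 < \<gamma> \<and> \<gamma> < \<beta>" and s: "s > 0"
    and complete: "all_terms_complete x s"
  shows "s \<le> \<beta>"
    and "\<exists>A c. finite A \<and> A \<subseteq> {0..1} \<and>
      eventually (\<lambda>t. decomp_fun 0 ((b, \<beta>) # ts) t powr s = powr_sum A c t) (at_right 0)"
proof -
  have "\<not> loses_information x s 1" using complete d
    by (auto simp: all_terms_complete_def num_terms_def)
  thus s\<beta>: "s \<le> \<beta>" using d by (simp add: loses_information_def term_order_def)
  show "\<exists>A c. finite A \<and> A \<subseteq> {0..1} \<and>
      eventually (\<lambda>t. decomp_fun 0 ((b, \<beta>) # ts) t powr s = powr_sum A c t) (at_right 0)"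
  proof (cases "ts = []")
    case True
    have "eventually (\<lambda>t. decomp_fun 0 ((b, \<beta>) # ts) t powr s
        = powr_sum {s / \<beta>} (\<lambda>_. b powr s) t) (at_right 0)"
      using eventually_at_right_less[of "0::real"]
      by eventually_elim (use True b in \<open>simp add: decomp_fun_def powr_sum_def powr_mult powr_powr\<close>)
    thus ?thesis using s s\<beta> by (intro exI[of _ "{s / \<beta>}"]) auto
  next
    case False
    define us where "us = (b, \<beta>) # ts"
    have N: "num_terms x = length us" "num_terms x \<ge> 2"
      using d False by (auto simp: num_terms_def us_def Suc_le_eq)
    have ord: "term_order x j = snd (us ! (j - 1))" for j
      using d by (simp add: term_order_def us_def)
    have "0 < term_order x j \<and> term_order x j < term_order x 1" if "j \<in> {2..num_terms x}" for j
    proof -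
      define i where "i = j - 2"
      have i: "j = Suc (Suc i)" using that by (auto simp: i_def)
      have "length us = Suc (length ts)" by (simp add: us_def)
      hence "i < length ts" using that N by (simp add: i)
      hence "ts ! i \<in> set ts" by simp
      hence "0 < snd (ts ! i) \<and> snd (ts ! i) < \<beta>" using ts by (auto simp: case_prod_beta)
      moreover have "us ! (j - 1) = ts ! i" "us ! (1 - 1) = (b, \<beta>)" by (simp_all add: i us_def)
      ultimately show ?thesis by (simp only: ord snd_conv)
    qed
    hence "\<exists>n\<ge>1. s = real n \<and> (\<forall>j\<in>{1..num_terms x}. real n \<le> term_order x j)"
      by (rule complete_imp_natural_exponent[OF _ N(2) s complete])
    then obtain n where n: "n \<ge> 1" "s = real n"
      and le: "\<forall>j\<in>{1..num_terms x}. real n \<le> term_order x j"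
      by blast
    have le': "real n \<le> \<gamma>" if "(c, \<gamma>) \<in> set us" for c \<gamma>
    proof -
      obtain i where "i < length us" "us ! i = (c, \<gamma>)" using \<open>(c, \<gamma>) \<in> set us\<close> by (auto simp: in_set_conv_nth)
      thus ?thesis using bspec[OF le, of "Suc i"] N by (simp add: ord)
    qed
    have ge1: "\<forall>(c, \<gamma>)\<in>set us. \<gamma> \<ge> 1" using le' n(1) by (force intro: order_trans[of 1 "real n"])
    have "1 / \<gamma> \<in> {0..1 / real n}" if "(c, \<gamma>) \<in> set us" for c \<gamma>
      using le'[OF that] n(1) by (simp add: frac_le)
    hence exps: "decomp_exps us \<subseteq> {0..1 / real n}"
      unfolding decomp_exps_def by auto
    have fin: "finite (decomp_exps us)" by (simp add: decomp_exps_def)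
    obtain B e where B: "finite B" "B \<subseteq> {0..real n * (1 / real n)}"
      "\<And>t. t > 0 \<Longrightarrow> powr_sum (decomp_exps us) (decomp_coeff 0 us) t ^ n = powr_sum B e t"
      using powr_sum_power[OF fin exps, of n "decomp_coeff 0 us"] by metis
    have "eventually (\<lambda>t. decomp_fun 0 us t powr s = powr_sum B e t) (at_right 0)"
      using eventually_at_right_less[of "0::real"]
        eventually_decomp_fun_pos[OF b ts, folded us_def]
    proof eventually_elim
      case (elim t)
      have "decomp_fun 0 us t powr s = decomp_fun 0 us t ^ n"
        using elim n by (simp add: powr_realpow)
      also have "\<dots> = powr_sum B e t"
        using decomp_fun_eq_powr_sum[OF ge1 fin subset_refl, of t 0] B(3) elim by simp
      finally show ?case .
    qed
    moreover have "B \<subseteq> {0..1}" using B(2) n(1) by simp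
    ultimately show ?thesis using B(1) unfolding us_def by blast
  qed
qed

section \<open>Left inverses and injectivity\<close>

lemma fpowr_complete_left_inverse:
  assumes "pos_infinitesimal x" "all_terms_complete x s" "s > 0"
  shows "fpowr (fpowr x s) (1 / s) = x"
proof -
  obtain b \<beta> ts where d: "decomposition x = (0, (b, \<beta>) # ts)"
    and *: "b > 0" "\<beta> \<ge> 1" "\<forall>(c, \<gamma>)\<in>set ts. 0 < \<gamma> \<and> \<gamma> < \<beta>"
    using pos_infinitesimal_decomposition[OF assms(1)] .
  note c = complete_imp_powr_sum[OF d * assms(3,2)]
  show ?thesis by (rule fpowr_left_inverse[OF assms(1) d assms(3) c(1) disjI2[OF c(2)]])
qed

text \<open>From q \<le> 1 \<le> \<beta> the order bound is automatic, and the second exponent 1 / q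
  falls into the Lipschitz case.\<close>

lemma fpowr_le_1_left_inverse:
  assumes "pos_infinitesimal x" "0 < q" "q \<le> 1"
  shows "fpowr (fpowr x q) (1 / q) = x"
proof -
  obtain b \<beta> ts where d: "decomposition x = (0, (b, \<beta>) # ts)" and \<beta>: "\<beta> \<ge> 1"
    using pos_infinitesimal_decomposition[OF assms(1)] .
  show ?thesis
    by (rule fpowr_left_inverse[OF assms(1) d]) (use assms \<beta> in auto)
qed

text \<open>The cancellation law makes the power 1 / p injective. Injectivity of the power p itself
  is restricted to p \<le> 1, since \<open>fpowr_not_inj\<close> refutes it for every p > 1.\<close>

theorem theorem36:
  fixes p :: real
  assumes "p > 0"
  shows "(\<forall>x \<in> D_infty. pos_infinitesimal x \<and> all_terms_complete x (1 / p) \<longrightarrow>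
            fpowr (fpowr x (1 / p)) p = x) \<and>
         inj_on (\<lambda>x. fpowr x (1 / p))
           ({x \<in> D_infty. pos_infinitesimal x \<and> all_terms_complete x (1 / p)} \<union>
            {y. std_part y > 0}) \<and>
         (p \<le> 1 \<longrightarrow>
          inj_on (\<lambda>x. fpowr x p)
            ({x \<in> D_infty. pos_infinitesimal x \<and> all_terms_complete x (1 / p)} \<union>
             {y. std_part y > 0}))"
proof (intro conjI ballI impI)
  fix x assume "pos_infinitesimal x \<and> all_terms_complete x (1 / p)"
  thus "fpowr (fpowr x (1 / p)) p = x"
    using fpowr_complete_left_inverse[of x "1 / p"] assms by simp
next
  \<comment> \<open>One left inverse serves both parts of the union, so their images need not be
    compared.\<close>
  show "inj_on (\<lambda>x. fpowr x (1 / p))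
     ({x \<in> D_infty. pos_infinitesimal x \<and> all_terms_complete x (1 / p)} \<union> {y. std_part y > 0})"
    using fpowr_complete_left_inverse[of _ "1 / p"] fpowr_std_pos_left_inverse[of _ "1 / p"] assms
    by (intro inj_on_inverseI[of _ "\<lambda>y. fpowr y p"]) auto
next
  assume "p \<le> 1"
  thus "inj_on (\<lambda>x. fpowr x p)
     ({x \<in> D_infty. pos_infinitesimal x \<and> all_terms_complete x (1 / p)} \<union> {y. std_part y > 0})"
    using fpowr_le_1_left_inverse[of _ p] fpowr_std_pos_left_inverse[of _ p] assms
    by (intro inj_on_inverseI[of _ "\<lambda>y. fpowr y (1 / p)"]) auto
qed

end
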